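(* Let $(M,g)$ be a pseudo-Riemannian manifold, let $I\subseteq\mathbb R$ be an open connected interval, let $f\colon I\to(0,\infty)$ be smooth, and let $\bar M=I\times_f M$ be the generalized Robertson-Walker space-time with metric $\bar g=-\mathrm dt^2\oplus f^2g$. If the concircular curvature tensor $\bar{\mathcal C}$ of $(\bar M,\bar g)$ is divergence free, then the concircular curvature tensor $\mathcal C$ of $(M,g)$ is divergence free. If, in addition, $f=at+b$ (with $a,b$ constants), then $(M,g)$ is Einstein.
   Context: With $\mathcal R(X,Y)Z=\nabla_Y\nabla_XZ-\nabla_X\nabla_YZ+\nabla_{[X,Y]}Z$ and $\mathcal R(X,Y,Z,V)=g(\mathcal R(X,Y)Z,V)$, the concircular curvature tensor of an $m$-dimensional pseudo-Riemannian manifold ($m\ge3$) with metric $g$ and scalar curvature $\tau$ is $\mathcal C(X,Y,Z,V)=\mathcal R(X,Y,Z,V)-\frac{\tau}{m(m-1)}[g(X,Z)g(Y,V)-g(Y,Z)g(X,V)]$; it is divergence free if $\nabla^{l}\mathcal C_{ijkl}=0$. The generalized Robertson-Walker space-time $I\times_f M$ is the product $I\times M$ with the metric $-\mathrm dt^2\oplus f(t)^2g$. $(M,g)$ is Einstein if its Ricci tensor is a constant multiple of $g$.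
   Formalization: In the second claim, f=at+b is taken with a≠0: for constant f the claim fails, e.g. M=S²×S³ (unit spheres), where I×M has parallel, hence divergence-free, concircular tensor but M is not Einstein; I is also assumed nonempty. *)

theory Defs
  imports "HOL-Analysis.Analysis"
begin

section \<open>Smooth maps on open subsets of Euclidean spaces\<close>

definition dir_deriv ::
  "('a::real_normed_vector \<Rightarrow> 'b::real_normed_vector) \<Rightarrow> 'a \<Rightarrow> 'a \<Rightarrow> 'b" where
  "dir_deriv f x v = frechet_derivative f (at x) v"

text \<open>Meant for open sets \<open>S\<close> only.\<close>

fun Ck_on ::
  "nat \<Rightarrow> ('a::euclidean_space \<Rightarrow> 'b::euclidean_space) \<Rightarrow> 'a set \<Rightarrow> bool" where
  "Ck_on 0 f S \<longleftrightarrow> continuous_on S f"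
| "Ck_on (Suc k) f S \<longleftrightarrow>
     (\<forall>x\<in>S. f differentiable (at x)) \<and> (\<forall>v. Ck_on k (\<lambda>x. dir_deriv f x v) S)"

definition smooth_on :: "('a::euclidean_space \<Rightarrow> 'b::euclidean_space) \<Rightarrow> 'a set \<Rightarrow> bool" where
  "smooth_on f S \<longleftrightarrow> (\<forall>k. Ck_on k f S)"


section \<open>Pseudo-Riemannian geometry in a coordinate domain\<close>

text \<open>
  Here \<open>G\<close> is a metric on an open subset of the model space \<open>'a\<close>: \<open>G x u v\<close> is the product
  at \<open>x\<close> of the tangent vectors \<open>u\<close> and \<open>v\<close>. Vector fields are maps \<open>'a \<Rightarrow> 'a\<close>, the
  coordinate fields are the constant maps with value in \<open>Basis\<close>, and covariant tensor fields
  are functions of a point and of tangent vectors there.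
\<close>

type_synonym 'a met = "'a \<Rightarrow> 'a \<Rightarrow> 'a \<Rightarrow> real"

text \<open>Raising an index: the vector representing the covector \<open>\<alpha>\<close>.\<close>

definition sharp :: "'a::euclidean_space met \<Rightarrow> 'a \<Rightarrow> ('a \<Rightarrow> real) \<Rightarrow> 'a" where
  "sharp G x \<alpha> = (THE w. \<forall>z. G x w z = \<alpha> z)"

text \<open>
  The entries \<open>g\<^sup>i\<^sup>j\<close> of the inverse matrix, for \<open>i\<close> and \<open>j\<close> in \<open>Basis\<close>:
  the sharp of the coordinate covector \<open>dx\<^sup>i\<close> is \<open>\<Sum>j. g\<^sup>i\<^sup>j e\<^sub>j\<close>.
\<close>

definition inv_met :: "'a::euclidean_space met \<Rightarrow> 'a met" where
  "inv_met G x i j = sharp G x (\<lambda>z. z \<bullet> i) \<bullet> j"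

text \<open>
  \<open>christoffel G x u v\<close> is \<open>\<Sum>i j k. u\<^sup>i v\<^sup>j \<Gamma>\<^sup>k\<^sub>i\<^sub>j e\<^sub>k\<close>, and \<open>nabla\<close> is the Levi-Civita connection.
\<close>

definition christoffel :: "'a::euclidean_space met \<Rightarrow> 'a \<Rightarrow> 'a \<Rightarrow> 'a \<Rightarrow> 'a" where
  "christoffel G x u v = sharp G x (\<lambda>z. 1/2 *
     (dir_deriv (\<lambda>y. G y v z) x u + dir_deriv (\<lambda>y. G y u z) x v - dir_deriv (\<lambda>y. G y u v) x z))"

definition nabla ::
  "'a::euclidean_space met \<Rightarrow> ('a \<Rightarrow> 'a) \<Rightarrow> ('a \<Rightarrow> 'a) \<Rightarrow> 'a \<Rightarrow> 'a" where
  "nabla G X Y x = dir_deriv Y x (X x) + christoffel G x (X x) (Y x)"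

definition lie_bracket ::
  "('a::euclidean_space \<Rightarrow> 'a) \<Rightarrow> ('a \<Rightarrow> 'a) \<Rightarrow> 'a \<Rightarrow> 'a" where
  "lie_bracket X Y x = dir_deriv Y x (X x) - dir_deriv X x (Y x)"

text \<open>The opposite of the most common sign convention.\<close>

definition curvature ::
  "'a::euclidean_space met \<Rightarrow> ('a \<Rightarrow> 'a) \<Rightarrow> ('a \<Rightarrow> 'a) \<Rightarrow> ('a \<Rightarrow> 'a) \<Rightarrow> 'a \<Rightarrow> 'a" where
  "curvature G X Y Z x =
     nabla G Y (nabla G X Z) x - nabla G X (nabla G Y Z) x + nabla G (lie_bracket X Y) Z x"

text \<open>
  The curvature being tensorial, its value on vectors is computed from their constant
  extensions.
\<close>

definition riemann ::
  "'a::euclidean_space met \<Rightarrow> 'a \<Rightarrow> 'a \<Rightarrow> 'a \<Rightarrow> 'a \<Rightarrow> 'a \<Rightarrow> real" where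
  "riemann G x u v w z = G x (curvature G (\<lambda>_. u) (\<lambda>_. v) (\<lambda>_. w) x) z"

text \<open>
  The contraction is chosen so that round spheres have positive Ricci and scalar curvature,
  that is, so that the concircular tensor below is totally trace free.
\<close>

definition ricci :: "'a::euclidean_space met \<Rightarrow> 'a met" where
  "ricci G x u v = (\<Sum>i\<in>Basis. \<Sum>j\<in>Basis. inv_met G x i j * riemann G x u i v j)"

definition scalar_curv :: "'a::euclidean_space met \<Rightarrow> 'a \<Rightarrow> real" where
  "scalar_curv G x = (\<Sum>i\<in>Basis. \<Sum>j\<in>Basis. inv_met G x i j * ricci G x i j)"

definition concircular ::
  "'a::euclidean_space met \<Rightarrow> 'a \<Rightarrow> 'a \<Rightarrow> 'a \<Rightarrow> 'a \<Rightarrow> 'a \<Rightarrow> real" where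
  "concircular G x u v w z = riemann G x u v w z
     - scalar_curv G x / (real DIM('a) * (real DIM('a) - 1))
       * (G x u w * G x v z - G x v w * G x u z)"

text \<open>\<open>cov_deriv4 G T x e u v w z\<close> is \<open>(\<nabla>\<^sub>e T)(u, v, w, z)\<close> at \<open>x\<close>.\<close>

definition cov_deriv4 ::
  "'a::euclidean_space met \<Rightarrow> ('a \<Rightarrow> 'a \<Rightarrow> 'a \<Rightarrow> 'a \<Rightarrow> 'a \<Rightarrow> real)
     \<Rightarrow> 'a \<Rightarrow> 'a \<Rightarrow> 'a \<Rightarrow> 'a \<Rightarrow> 'a \<Rightarrow> 'a \<Rightarrow> real" where
  "cov_deriv4 G T x e u v w z =
     dir_deriv (\<lambda>y. T y u v w z) x e
     - T x (christoffel G x e u) v w z - T x u (christoffel G x e v) w z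
     - T x u v (christoffel G x e w) z - T x u v w (christoffel G x e z)"

text \<open>\<open>\<nabla>\<^sup>l T\<^sub>i\<^sub>j\<^sub>k\<^sub>l\<close>: the derivative index is contracted with the last one.\<close>

definition divergence4 ::
  "'a::euclidean_space met \<Rightarrow> ('a \<Rightarrow> 'a \<Rightarrow> 'a \<Rightarrow> 'a \<Rightarrow> 'a \<Rightarrow> real)
     \<Rightarrow> 'a \<Rightarrow> 'a \<Rightarrow> 'a \<Rightarrow> 'a \<Rightarrow> real" where
  "divergence4 G T x u v w =
     (\<Sum>p\<in>Basis. \<Sum>l\<in>Basis. inv_met G x p l * cov_deriv4 G T x p u v w l)"


section \<open>Pseudo-Riemannian manifolds\<close>

text \<open>
  A manifold modelled on \<open>'a\<close>, hence of dimension \<open>DIM('a)\<close>, is given by an indexed atlas;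
  \<open>coord M i\<close> is a chart with domain \<open>chart_dom M i\<close>. The metric is given classically, by its
  components \<open>met M i\<close> on the image of each chart, with the transformation law of a
  (0,2)-tensor. Values of \<open>coord M i\<close> and \<open>met M i\<close> outside these sets are irrelevant.
\<close>

record ('i, 'p, 'a) mfd =
  mtop :: "'p topology"
  charts :: "'i set"
  chart_dom :: "'i \<Rightarrow> 'p set"
  coord :: "'i \<Rightarrow> 'p \<Rightarrow> 'a"
  met :: "'i \<Rightarrow> 'a met"

definition img :: "('i, 'p, 'a) mfd \<Rightarrow> 'i \<Rightarrow> 'a set" where
  "img M i = coord M i ` chart_dom M i"

definition transition :: "('i, 'p, 'a) mfd \<Rightarrow> 'i \<Rightarrow> 'i \<Rightarrow> 'a \<Rightarrow> 'a" where
  "transition M i j = coord M j \<circ> inv_into (chart_dom M i) (coord M i)"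

definition smooth_manifold :: "('i, 'p, 'a::euclidean_space) mfd \<Rightarrow> bool" where
  "smooth_manifold M \<longleftrightarrow>
     Hausdorff_space (mtop M) \<and> second_countable (mtop M) \<and>
     topspace (mtop M) = (\<Union>i\<in>charts M. chart_dom M i) \<and>
     (\<forall>i\<in>charts M. openin (mtop M) (chart_dom M i) \<and> open (img M i) \<and>
        homeomorphic_map (subtopology (mtop M) (chart_dom M i)) (top_of_set (img M i)) (coord M i)) \<and>
     (\<forall>i\<in>charts M. \<forall>j\<in>charts M.
        smooth_on (transition M i j) (coord M i ` (chart_dom M i \<inter> chart_dom M j)))"

definition pseudo_riemannian_manifold :: "('i, 'p, 'a::euclidean_space) mfd \<Rightarrow> bool" where
  "pseudo_riemannian_manifold M \<longleftrightarrow>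
     smooth_manifold M \<and>
     (\<forall>i\<in>charts M.
        (\<forall>u v. smooth_on (\<lambda>x. met M i x u v) (img M i)) \<and>
        (\<forall>x\<in>img M i. bilinear (met M i x) \<and>
           (\<forall>u v. met M i x u v = met M i x v u) \<and>
           (\<forall>u. (\<forall>v. met M i x u v = 0) \<longrightarrow> u = 0))) \<and>
     (\<forall>i\<in>charts M. \<forall>j\<in>charts M. \<forall>p\<in>chart_dom M i \<inter> chart_dom M j. \<forall>u v.
        met M i (coord M i p) u v =
        met M j (coord M j p) (dir_deriv (transition M i j) (coord M i p) u)
                              (dir_deriv (transition M i j) (coord M i p) v))"

definition concircular_divergence_free :: "('i, 'p, 'a::euclidean_space) mfd \<Rightarrow> bool" where
  "concircular_divergence_free M \<longleftrightarrow>
     (\<forall>i\<in>charts M. \<forall>x\<in>img M i. \<forall>u v w.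
        divergence4 (met M i) (concircular (met M i)) x u v w = 0)"

definition einstein :: "('i, 'p, 'a::euclidean_space) mfd \<Rightarrow> bool" where
  "einstein M \<longleftrightarrow>
     (\<exists>c. \<forall>i\<in>charts M. \<forall>x\<in>img M i. \<forall>u v. ricci (met M i) x u v = c * met M i x u v)"

text \<open>
  The space-time \<open>I \<times>\<^sub>f M\<close>, with the product charts \<open>id \<times> coord M i\<close> on \<open>I \<times> chart_dom M i\<close>
  and the metric \<open>- dt\<^sup>2 \<oplus> f\<^sup>2 g\<close>.
\<close>

definition grw ::
  "real set \<Rightarrow> (real \<Rightarrow> real) \<Rightarrow> ('i, 'p, 'a::euclidean_space) mfd
     \<Rightarrow> ('i, real \<times> 'p, real \<times> 'a) mfd" where
  "grw I f M =
     \<lparr> mtop = prod_topology (top_of_set I) (mtop M),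
       charts = charts M,
       chart_dom = (\<lambda>i. I \<times> chart_dom M i),
       coord = (\<lambda>i (t, p). (t, coord M i p)),
       met = (\<lambda>i (t, x) (r, u) (s, v). - (r * s) + (f t)\<^sup>2 * met M i x u v) \<rparr>"

end

theory Submission
  imports Defs
begin

text \<open>
  In terms of \<open>F = f\<^sup>2\<close>, \<open>q = f' / f\<close> and \<open>p = q'\<close>, write \<open>W\<close> for the tensor
  \<open>g(u,w) g(v,z) - g(v,w) g(u,z)\<close>, \<open>\<kappa>\<close> for the scalar curvature of the
  space-time divided by \<open>n (n + 1)\<close>, where \<open>n\<close> is the dimension of \<open>M\<close>, and \<open>\<tau>\<close>
  for the scalar curvature of \<open>M\<close>. The concircular tensor of the space-time is
  \<open>F R + (q\<^sup>2 - \<kappa>) F\<^sup>2 W\<close> on spatial vectors, and it is \<open>A g(v,z)\<close> with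
  \<open>A = (\<kappa> - p - q\<^sup>2) F\<close> on \<open>(\<partial>\<^sub>t, v, \<partial>\<^sub>t, z)\<close>. Three components of its divergence suffice.
  The component \<open>(\<partial>\<^sub>t, v, \<partial>\<^sub>t)\<close> is a nonzero multiple of \<open>d\<tau>(v)\<close>, so that \<open>\<tau>\<close> is locally
  constant, without any appeal to the Bianchi identities. The purely spatial component is then
  the divergence of \<open>R\<close>, hence that of the concircular tensor of \<open>M\<close>. Finally, for \<open>f'' = 0\<close>,
  the component \<open>(\<partial>\<^sub>t, v, w)\<close> is \<open>q\<close> times \<open>Ric - (2 A - (n - 1) f'\<^sup>2) g\<close>.
\<close>

section \<open>Smooth maps\<close>

lemma has_derivative_dir_deriv:
  "f differentiable at x \<Longrightarrow> (f has_derivative dir_deriv f x) (at x)"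
  unfolding dir_deriv_def using frechet_derivative_works by metis

lemma dir_deriv_eqI: "(f has_derivative f') (at x) \<Longrightarrow> dir_deriv f x v = f' v"
  unfolding dir_deriv_def using frechet_derivative_at by metis

lemma linear_dir_deriv: "f differentiable at x \<Longrightarrow> linear (dir_deriv f x)"
  using has_derivative_dir_deriv has_derivative_linear by blast

text \<open>Both maps have the same derivatives at \<open>x\<close>, so the choice inside
  \<open>frechet_derivative\<close> is the same, whether or not a derivative exists.\<close>

lemma dir_deriv_cong:
  assumes "open S" "x \<in> S" "\<And>y. y \<in> S \<Longrightarrow> f y = g y"
  shows "dir_deriv f x v = dir_deriv g x v"
proof -
  have "(f has_derivative D) (at x) \<longleftrightarrow> (g has_derivative D) (at x)" for D
    using assms has_derivative_transform_within_open[of _ D x UNIV S] by metis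
  then show ?thesis
    unfolding dir_deriv_def frechet_derivative_def by simp
qed

lemma differentiable_cong_open:
  assumes "open S" "x \<in> S" "\<And>y. y \<in> S \<Longrightarrow> f y = g y" "f differentiable at x"
  shows "g differentiable at x"
  using assms has_derivative_transform_within_open unfolding differentiable_def by metis

lemma dir_deriv_const [simp]: "dir_deriv (\<lambda>_. c) x v = 0"
  by (rule dir_deriv_eqI) auto

lemma dir_deriv_add:
  "f differentiable at x \<Longrightarrow> g differentiable at x \<Longrightarrow>
    dir_deriv (\<lambda>y. f y + g y) x v = dir_deriv f x v + dir_deriv g x v"
  by (rule dir_deriv_eqI) (auto intro!: derivative_intros has_derivative_dir_deriv)

lemma dir_deriv_cmult: "f differentiable at x \<Longrightarrow> dir_deriv (\<lambda>y. c * f y) x v = c * dir_deriv f x v"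
  for f :: "_ \<Rightarrow> real"
  by (rule dir_deriv_eqI) (auto intro!: derivative_eq_intros has_derivative_dir_deriv)

lemma dir_deriv_scaleR: "f differentiable at x \<Longrightarrow> dir_deriv (\<lambda>y. c *\<^sub>R f y) x v = c *\<^sub>R dir_deriv f x v"
  by (rule dir_deriv_eqI) (auto intro!: derivative_eq_intros has_derivative_dir_deriv)

lemma dir_deriv_bilinear:
  fixes prod :: "'b::euclidean_space \<Rightarrow> 'c::euclidean_space \<Rightarrow> 'd::euclidean_space"
    and f :: "'a::euclidean_space \<Rightarrow> 'b" and g :: "'a \<Rightarrow> 'c"
  assumes "bounded_bilinear prod" "f differentiable at x" "g differentiable at x"
  shows "dir_deriv (\<lambda>y. prod (f y) (g y)) x v =
    prod (f x) (dir_deriv g x v) + prod (dir_deriv f x v) (g x)"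
  by (rule dir_deriv_eqI) (intro bounded_bilinear.FDERIV assms has_derivative_dir_deriv)

lemma differentiable_bilinear:
  fixes prod :: "'b::euclidean_space \<Rightarrow> 'c::euclidean_space \<Rightarrow> 'd::euclidean_space"
    and f :: "'a::euclidean_space \<Rightarrow> 'b" and g :: "'a \<Rightarrow> 'c"
  assumes "bounded_bilinear prod" "f differentiable at x" "g differentiable at x"
  shows "(\<lambda>y. prod (f y) (g y)) differentiable at x"
  using bounded_bilinear.FDERIV[OF assms(1) has_derivative_dir_deriv has_derivative_dir_deriv]
    assms unfolding differentiable_def by blast

section \<open>Closure properties of \<open>Ck_on\<close> and of smooth maps\<close>

lemma Ck_on_cong:
  assumes "open S" "\<And>x. x \<in> S \<Longrightarrow> f x = g x" "Ck_on k f S"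
  shows "Ck_on k g S"
  using assms(2,3)
proof (induction k arbitrary: f g)
  case 0
  then show ?case by (simp cong: continuous_on_cong)
next
  case (Suc k)
  have "g differentiable at x" if "x \<in> S" for x
    using differentiable_cong_open[OF assms(1) that Suc.prems(1)] Suc.prems(2) that by simp
  moreover have "Ck_on k (\<lambda>x. dir_deriv g x v) S" for v
    using Suc.IH[of "\<lambda>x. dir_deriv f x v"] dir_deriv_cong[OF assms(1) _ Suc.prems(1)] Suc.prems(2)
    by simp
  ultimately show ?case by simp
qed

lemma Ck_on_SucD: "Ck_on (Suc k) f S \<Longrightarrow> Ck_on k f S"
proof (induction k arbitrary: f)
  case 0
  then show ?case
    by (auto intro!: continuous_at_imp_continuous_on differentiable_imp_continuous_within)
qed auto

lemma Ck_on_const: "Ck_on k (\<lambda>_. c) S"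
proof (induction k arbitrary: c)
  case (Suc k)
  from Suc[of 0] show ?case by simp
qed simp

lemma Ck_on_add:
  assumes "open S" "Ck_on k f S" "Ck_on k g S"
  shows "Ck_on k (\<lambda>x. f x + g x) S"
  using assms(2,3)
proof (induction k arbitrary: f g)
  case 0
  then show ?case by (auto intro: continuous_intros)
next
  case (Suc k)
  then have "Ck_on k (\<lambda>x. dir_deriv f x v + dir_deriv g x v) S" for v
    by simp
  then have "Ck_on k (\<lambda>x. dir_deriv (\<lambda>x. f x + g x) x v) S" for v
    by (rule Ck_on_cong[OF assms(1), rotated]) (use Suc.prems in \<open>simp add: dir_deriv_add\<close>)
  then show ?case using Suc.prems by simp
qed

text \<open>The Leibniz rule gives a derivative that is again a sum of such products, so the
  induction on the order closes. Products, scalar multiples and inner products are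
  instances.\<close>

lemma Ck_on_bilinear:
  fixes prod :: "'b::euclidean_space \<Rightarrow> 'c::euclidean_space \<Rightarrow> 'd::euclidean_space"
    and f :: "'a::euclidean_space \<Rightarrow> 'b" and g :: "'a \<Rightarrow> 'c"
  assumes "open S" "bounded_bilinear prod" "Ck_on k f S" "Ck_on k g S"
  shows "Ck_on k (\<lambda>x. prod (f x) (g x)) S"
  using assms(3,4)
proof (induction k arbitrary: f g)
  case 0
  then show ?case by (auto intro: bounded_bilinear.continuous_on[OF assms(2)])
next
  case (Suc k)
  have "Ck_on k (\<lambda>x. prod (f x) (dir_deriv g x v) + prod (dir_deriv f x v) (g x)) S" for v
    using Suc.prems Suc.IH by (intro Ck_on_add[OF assms(1)] Suc.IH) (auto intro: Ck_on_SucD)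
  then have "Ck_on k (\<lambda>x. dir_deriv (\<lambda>x. prod (f x) (g x)) x v) S" for v
    by (rule Ck_on_cong[OF assms(1), rotated])
      (use Suc.prems in \<open>simp add: dir_deriv_bilinear[OF assms(2)]\<close>)
  then show ?case using Suc.prems by (simp add: differentiable_bilinear[OF assms(2)])
qed

lemma Ck_on_sum:
  assumes "open S" "\<And>i. i \<in> A \<Longrightarrow> Ck_on k (f i) S"
  shows "Ck_on k (\<lambda>x. \<Sum>i\<in>A. f i x) S"
  using assms(2)
  by (induction A rule: infinite_finite_induct) (auto intro: Ck_on_const Ck_on_add[OF assms(1)])

lemma smooth_on_differentiable: "smooth_on f S \<Longrightarrow> x \<in> S \<Longrightarrow> f differentiable at x"
  unfolding smooth_on_def by (metis Ck_on.simps(2))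

lemma smooth_on_dir_deriv: "smooth_on f S \<Longrightarrow> smooth_on (\<lambda>x. dir_deriv f x v) S"
  unfolding smooth_on_def by (metis Ck_on.simps(2))

lemma smooth_on_cong:
  "open S \<Longrightarrow> (\<And>x. x \<in> S \<Longrightarrow> f x = g x) \<Longrightarrow> smooth_on f S \<Longrightarrow> smooth_on g S"
  unfolding smooth_on_def using Ck_on_cong by blast

lemma smooth_on_const: "smooth_on (\<lambda>_. c) S"
  unfolding smooth_on_def using Ck_on_const by blast

lemma smooth_on_add:
  "open S \<Longrightarrow> smooth_on f S \<Longrightarrow> smooth_on g S \<Longrightarrow> smooth_on (\<lambda>x. f x + g x) S"
  unfolding smooth_on_def using Ck_on_add by blast

lemma smooth_on_bilinear:
  fixes prod :: "'b::euclidean_space \<Rightarrow> 'c::euclidean_space \<Rightarrow> 'd::euclidean_space"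
    and f :: "'a::euclidean_space \<Rightarrow> 'b" and g :: "'a \<Rightarrow> 'c"
  shows "open S \<Longrightarrow> bounded_bilinear prod \<Longrightarrow> smooth_on f S \<Longrightarrow> smooth_on g S \<Longrightarrow>
    smooth_on (\<lambda>x. prod (f x) (g x)) S"
  unfolding smooth_on_def using Ck_on_bilinear by blast

lemmas smooth_on_mult = smooth_on_bilinear[OF _ bounded_bilinear_mult]
lemmas smooth_on_scaleR = smooth_on_bilinear[OF _ bounded_bilinear_scaleR]
lemmas smooth_on_inner = smooth_on_bilinear[OF _ bounded_bilinear_inner]

lemma smooth_on_minus:
  fixes f g :: "'a::euclidean_space \<Rightarrow> 'b::euclidean_space"
  assumes "open S" "smooth_on f S" "smooth_on g S"
  shows "smooth_on (\<lambda>x. f x - g x) S"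
proof -
  have "smooth_on (\<lambda>x. (-1) *\<^sub>R g x) S"
    by (intro smooth_on_scaleR smooth_on_const assms)
  from smooth_on_add[OF assms(1,2) this] show ?thesis by simp
qed

lemma smooth_on_sum:
  "open S \<Longrightarrow> (\<And>i. i \<in> A \<Longrightarrow> smooth_on (f i) S) \<Longrightarrow> smooth_on (\<lambda>x. \<Sum>i\<in>A. f i x) S"
  unfolding smooth_on_def by (simp add: Ck_on_sum)

lemmas smooth_intros = smooth_on_const smooth_on_add smooth_on_mult smooth_on_scaleR
  smooth_on_inner smooth_on_minus smooth_on_sum smooth_on_dir_deriv

text \<open>A Leibniz rule for a factor \<open>\<phi>\<close> that is merely continuous, which
  suffices where \<open>\<psi>\<close> vanishes. The error splits into \<open>\<phi> y\<close> times
  the remainder of \<open>\<psi>\<close> and \<open>(\<phi> y - \<phi> x) * D (y - x)\<close>, the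
  latter small because \<open>D\<close> is bounded. It serves for the inverse matrix, whose
  continuity is known before its differentiability.\<close>

lemma has_derivative_mult_vanishing:
  fixes \<phi> \<psi> :: "'a::real_normed_vector \<Rightarrow> real"
  assumes "isCont \<phi> x" "(\<psi> has_derivative D) (at x)" "\<psi> x = 0"
  shows "((\<lambda>y. \<phi> y * \<psi> y) has_derivative (\<lambda>v. \<phi> x * D v)) (at x)"
proof -
  have bl: "bounded_linear D"
    using assms(2) has_derivative_bounded_linear by blast
  obtain K where K: "\<And>v. norm (D v) \<le> norm v * K" "0 < K"
      using bounded_linear.pos_bounded[OF bl] by blast
  have d: "((\<lambda>y. (\<psi> y - D (y - x)) /\<^sub>R norm (y - x)) \<longlongrightarrow> 0) (at x)"
    using assms(2,3) by (simp add: has_derivative_at_within)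
  have "((\<lambda>y. \<phi> y * ((\<psi> y - D (y - x)) /\<^sub>R norm (y - x))) \<longlongrightarrow> \<phi> x * 0) (at x)"
    using assms(1) by (intro tendsto_mult d) (simp add: isCont_def)
  moreover have "((\<lambda>y. (\<phi> y - \<phi> x) * (D (y - x) /\<^sub>R norm (y - x))) \<longlongrightarrow> 0) (at x)"
  proof (rule Lim_null_comparison)
    have "norm (D (y - x) /\<^sub>R norm (y - x)) \<le> K" for y
      using K(1)[of "y - x"] K(2) by (cases "y = x") (auto simp: field_simps)
    then have "norm ((\<phi> y - \<phi> x) * (D (y - x) /\<^sub>R norm (y - x))) \<le> \<bar>\<phi> y - \<phi> x\<bar> * K" for y
      unfolding real_norm_def abs_mult by (intro mult_left_mono) auto
    then show "\<forall>\<^sub>F y in at x. norm ((\<phi> y - \<phi> x) * (D (y - x) /\<^sub>R norm (y - x))) \<le> \<bar>\<phi> y - \<phi> x\<bar> * K"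
      by simp
    show "((\<lambda>y. \<bar>\<phi> y - \<phi> x\<bar> * K) \<longlongrightarrow> 0) (at x)"
      using assms(1) unfolding isCont_def by (auto intro!: tendsto_eq_intros)
  qed
  ultimately have "((\<lambda>y. \<phi> y * ((\<psi> y - D (y - x)) /\<^sub>R norm (y - x)) +
      (\<phi> y - \<phi> x) * (D (y - x) /\<^sub>R norm (y - x))) \<longlongrightarrow> 0) (at x)"
    by (auto intro: tendsto_eq_intros)
  moreover have "(\<lambda>y. \<phi> y * ((\<psi> y - D (y - x)) /\<^sub>R norm (y - x)) +
      (\<phi> y - \<phi> x) * (D (y - x) /\<^sub>R norm (y - x))) =
      (\<lambda>y. (\<phi> y * \<psi> y - \<phi> x * D (y - x)) /\<^sub>R norm (y - x))"
    by (auto simp: algebra_simps)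
  ultimately show ?thesis
    using bl assms(3) by (simp add: has_derivative_at_within bounded_linear_const_mult)
qed

section \<open>The Levi-Civita connection of a chart metric\<close>

text \<open>These are the clauses of \<open>pseudo_riemannian_manifold\<close> for a single chart.
  Vanishing divergence and, for a fixed constant, the Einstein equation are stated chart by chart,
  so the geometry can be done here.\<close>

locale chart_metric =
  fixes S :: "'a::euclidean_space set" and G :: "'a met"
  assumes open_S: "open S"
    and smooth_G: "smooth_on (\<lambda>x. G x u v) S"
    and bilinear_G: "x \<in> S \<Longrightarrow> bilinear (G x)"
    and sym_G: "x \<in> S \<Longrightarrow> G x u v = G x v u"
    and nondegenerate: "x \<in> S \<Longrightarrow> (\<And>v. G x u v = 0) \<Longrightarrow> u = 0"
begin

abbreviation "h \<equiv> inv_met G"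
abbreviation "\<Gamma> \<equiv> christoffel G"

lemma diff_G: "x \<in> S \<Longrightarrow> (\<lambda>y. G y u v) differentiable at x"
  using smooth_G smooth_on_differentiable by blast

section \<open>Linear algebra of the metric at one point\<close>

context
  fixes x assumes x: "x \<in> S"
begin

lemma linear_G: "linear (G x u)" "linear (\<lambda>u. G x u v)"
  using bilinear_G[OF x] unfolding bilinear_def by auto

lemma G_simps:
  "G x (u + u') v = G x u v + G x u' v" "G x u (v + v') = G x u v + G x u v'"
  "G x (u - u') v = G x u v - G x u' v" "G x u (v - v') = G x u v - G x u v'"
  "G x (c *\<^sub>R u) v = c * G x u v" "G x u (c *\<^sub>R v) = c * G x u v"
  "G x (- u) v = - G x u v" "G x u (- v) = - G x u v"
  "G x 0 v = 0" "G x u 0 = 0"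
  using bilinear_G[OF x]
  by (simp_all add: bilinear_ladd bilinear_radd bilinear_lsub bilinear_rsub bilinear_lmul
      bilinear_rmul bilinear_lneg bilinear_rneg bilinear_lzero bilinear_rzero)

lemma G_sum: "G x (\<Sum>i\<in>A. w i) v = (\<Sum>i\<in>A. G x (w i) v)" "G x v (\<Sum>i\<in>A. w i) = (\<Sum>i\<in>A. G x v (w i))"
  using linear_sum[OF linear_G(2)] linear_sum[OF linear_G(1)] by simp_all

lemma G_eq_iff: "(\<And>z. G x u z = G x v z) \<Longrightarrow> u = v"
  using nondegenerate[OF x, of "u - v"] by (simp add: G_simps)

lemma sharp_eqI: "(\<And>z. G x w z = \<alpha> z) \<Longrightarrow> sharp G x \<alpha> = w"
  unfolding sharp_def by (rule the_equality) (auto intro: G_eq_iff)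

text \<open>The covector \<open>G x w\<close> turned into a vector by the Euclidean inner product,
  so that lowering an index becomes an endomorphism of the model space.\<close>

definition flat :: "'a \<Rightarrow> 'a" where
  "flat w = (\<Sum>j\<in>Basis. G x w j *\<^sub>R j)"

lemma linear_flat: "linear flat"
  unfolding flat_def
  by (rule linearI) (simp_all add: G_simps scaleR_add_left sum.distrib scaleR_sum_right)

lemma flat_inner: "flat w \<bullet> z = G x w z"
proof -
  have "flat w \<bullet> z = (\<Sum>j\<in>Basis. G x w ((z \<bullet> j) *\<^sub>R j))"
    unfolding flat_def by (simp add: inner_sum_left inner_sum_right inner_commute[of _ z] G_simps mult.commute)
  also have "\<dots> = G x w (\<Sum>j\<in>Basis. (z \<bullet> j) *\<^sub>R j)" by (simp add: G_sum)
  finally show ?thesis by (simp add: euclidean_representation)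
qed

lemma inj_flat: "inj flat"
  by (metis injI G_eq_iff flat_inner)

lemma linear_basis_expansion: "linear \<alpha> \<Longrightarrow> (\<alpha> z :: real) = (\<Sum>i\<in>Basis. \<alpha> i * (z \<bullet> i))"
  for z :: 'a
  apply (subst euclidean_representation[of z, symmetric])
  apply (subst linear_sum, assumption)
  by (simp add: linear_scale mult.commute)

lemma linear_inner_basis: "linear \<alpha> \<Longrightarrow> (\<Sum>i\<in>Basis. \<alpha> i *\<^sub>R i) \<bullet> z = (\<alpha> z :: real)" for z :: 'a
  by (simp add: linear_basis_expansion[of \<alpha> z] inner_sum_left inner_sum_right inner_commute[of _ z])

text \<open>Nondegeneracy makes \<open>flat\<close> injective, hence surjective in finite dimension;
  so every linear covector is represented and the description in \<open>sharp\<close> is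
  meaningful.\<close>

lemma G_sharp:
  assumes "linear \<alpha>"
  shows "G x (sharp G x \<alpha>) z = \<alpha> z"
proof -
  have "surj flat" using linear_injective_imp_surjective[OF linear_flat inj_flat] by simp
  then obtain w where w: "flat w = (\<Sum>i\<in>Basis. \<alpha> i *\<^sub>R i)" by (metis surjD)
  then have "G x w z = \<alpha> z" for z using flat_inner linear_inner_basis[OF assms] by metis
  then show ?thesis using sharp_eqI by metis
qed

lemma G_sharp_coord: "G x (sharp G x (\<lambda>z. z \<bullet> i)) z = z \<bullet> i"
  by (rule G_sharp) (simp add: bounded_linear_inner_left bounded_linear.linear)

lemma h_sym: "h x i j = h x j i"
  unfolding inv_met_def using G_sharp_coord sym_G[OF x] by metis

lemma sharp_coord: "sharp G x (\<lambda>z. z \<bullet> i) = (\<Sum>j\<in>Basis. h x i j *\<^sub>R j)"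
  unfolding inv_met_def by (simp add: euclidean_representation)

lemma sharp_linear:
  assumes "linear \<alpha>"
  shows "sharp G x \<alpha> = (\<Sum>i\<in>Basis. \<Sum>j\<in>Basis. (\<alpha> i * h x i j) *\<^sub>R j)"
proof -
  have "sharp G x \<alpha> = (\<Sum>i\<in>Basis. \<alpha> i *\<^sub>R sharp G x (\<lambda>z. z \<bullet> i))"
    by (intro sharp_eqI)
      (simp add: G_sum G_simps G_sharp_coord linear_basis_expansion[OF assms, symmetric])
  then show ?thesis by (simp add: sharp_coord scaleR_sum_right)
qed

text \<open>Lowering the index of \<open>v\<close> and raising it again returns \<open>v\<close>;
  then \<open>\<beta>\<close> is applied to the coordinate expansion.\<close>

lemma contract:
  assumes "linear \<beta>"
  shows "(\<Sum>i\<in>Basis. \<Sum>j\<in>Basis. h x i j * (G x v i * \<beta> j)) = (\<beta> v :: real)"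
proof -
  have "v = sharp G x (G x v)" by (rule sharp_eqI[symmetric]) simp
  also have "\<dots> = (\<Sum>i\<in>Basis. \<Sum>j\<in>Basis. (G x v i * h x i j) *\<^sub>R j)"
    by (rule sharp_linear) (rule linear_G)
  finally have "\<beta> v = \<beta> (\<Sum>i\<in>Basis. \<Sum>j\<in>Basis. (G x v i * h x i j) *\<^sub>R j)" by simp
  also have "\<dots> = (\<Sum>i\<in>Basis. \<Sum>j\<in>Basis. h x i j * (G x v i * \<beta> j))"
    using assms by (simp add: linear_sum linear_scale algebra_simps)
  finally show ?thesis by simp
qed

lemma contract':
  assumes "linear \<beta>"
  shows "(\<Sum>i\<in>Basis. \<Sum>j\<in>Basis. h x i j * (\<beta> i * G x v j)) = (\<beta> v :: real)"
  using contract[OF assms, of v]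
  by (subst sum.swap) (simp add: h_sym[of _ i for i] mult.commute)

text \<open>The trace of the identity: each inner sum is a diagonal entry of the inverse matrix
  times the matrix.\<close>

lemma contract_G: "(\<Sum>i\<in>Basis. \<Sum>j\<in>Basis. h x i j * G x i j) = DIM('a)"
proof -
  have "(\<Sum>j\<in>Basis. h x i j * G x i j) = 1" if "i \<in> Basis" for i :: 'a
    using G_sharp_coord[of i i] that sym_G[OF x]
    by (simp add: sharp_coord G_sum G_simps)
  then show ?thesis by simp
qed

end

section \<open>Smoothness of the inverse matrix\<close>

lemma h_difference:
  assumes "x \<in> S" "y \<in> S"
  shows "h y i j - h x i j = - (\<Sum>k\<in>Basis. \<Sum>l\<in>Basis. h y i k * h x j l * (G y k l - G x k l))"
proof -
  \<comment> \<open>The metrics at \<open>x\<close> and \<open>y\<close> are evaluated on one pair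
    of sharps: \<open>G x\<close> returns \<open>h y i j\<close> and \<open>G y\<close> returns
    \<open>h x j i\<close>. Their difference is the resolvent identity
    \<open>H' - H = - H' (G' - G) H\<close> for inverse matrices.\<close>
  have expand: "G z (sharp G y (\<lambda>z. z \<bullet> i)) (sharp G x (\<lambda>z. z \<bullet> j)) =
      (\<Sum>k\<in>Basis. \<Sum>l\<in>Basis. h y i k * h x j l * G z k l)" if "z \<in> S" for z
    using assms that
    by (subst sum.swap) (simp add: sharp_coord G_sum G_simps sum_distrib_left mult_ac)
  have "h y i j = G x (sharp G y (\<lambda>z. z \<bullet> i)) (sharp G x (\<lambda>z. z \<bullet> j))"
    unfolding inv_met_def using G_sharp_coord[OF assms(1)] sym_G[OF assms(1)] by metis
  moreover have "h x j i = G y (sharp G y (\<lambda>z. z \<bullet> i)) (sharp G x (\<lambda>z. z \<bullet> j))"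
    unfolding inv_met_def using G_sharp_coord[OF assms(2)] by metis
  ultimately show ?thesis
    using h_sym[OF assms(1), of i j] expand assms
    by (simp add: algebra_simps sum_subtractf)
qed

lemma G_tendsto: "x \<in> S \<Longrightarrow> ((\<lambda>y. G y u v) \<longlongrightarrow> G x u v) (at x)"
  using differentiable_imp_continuous_within[OF diff_G] by (simp add: continuous_within)

text \<open>The map \<open>flat\<close> at \<open>x\<close> is bounded below by some
  \<open>B\<close>, and near \<open>x\<close> the map \<open>flat\<close> at \<open>y\<close>
  differs from it by at most \<open>B / 2\<close>. Since \<open>flat\<close> at \<open>y\<close>
  sends the sharp to the unit vector \<open>i\<close>, its norm is at most
  \<open>2 / B\<close>.\<close>

lemma sharp_coord_locally_bounded:
  assumes x: "x \<in> S" and i: "i \<in> Basis"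
  shows "\<exists>K. \<forall>\<^sub>F y in at x. norm (sharp G y (\<lambda>z. z \<bullet> i)) \<le> K"
proof -
  obtain B where B: "B > 0" "\<And>w. B * norm w \<le> norm (flat x w)"
    using linear_inj_bounded_below_pos[OF linear_flat[OF x] inj_flat[OF x]] by blast
  \<comment> \<open>The entrywise distance between the matrices at \<open>y\<close> and at
    \<open>x\<close>; it bounds the operator norm of the difference of the two maps
    \<open>flat\<close>.\<close>
  define \<epsilon> where "\<epsilon> y = (\<Sum>j\<in>Basis. \<Sum>k\<in>Basis. \<bar>G y k j - G x k j\<bar>)" for y
  have "(\<epsilon> \<longlongrightarrow> (\<Sum>j\<in>(Basis::'a set). \<Sum>k\<in>(Basis::'a set). \<bar>G x k j - G x k j\<bar>)) (at x)"
    unfolding \<epsilon>_def by (intro tendsto_intros G_tendsto x)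
  then have "\<forall>\<^sub>F y in at x. \<epsilon> y < B / 2"
    using B(1) by (intro order_tendstoD(2)[where y = 0]) simp_all
  moreover have "\<forall>\<^sub>F y in at x. y \<in> S"
    using eventually_at_in_open'[OF open_S x] .
  ultimately have "\<forall>\<^sub>F y in at x. norm (sharp G y (\<lambda>z. z \<bullet> i)) \<le> 2 / B"
  proof eventually_elim
    case (elim y)
    define w where "w = sharp G y (\<lambda>z. z \<bullet> i)"
    have G_w: "G z w j = (\<Sum>k\<in>Basis. (w \<bullet> k) * G z k j)" if "z \<in> S" for z j
      using that by (subst (1) euclidean_representation[of w, symmetric]) (simp add: G_sum G_simps)
    have "flat y w = (\<Sum>j\<in>Basis. (i \<bullet> j) *\<^sub>R j)"
      unfolding flat_def[OF elim(2)] w_def G_sharp_coord[OF elim(2)] by (simp add: inner_commute)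
    then have "flat y w = i"
      by (simp add: euclidean_representation)
    have "flat x w - flat y w = (\<Sum>j\<in>Basis. (\<Sum>k\<in>Basis. (w \<bullet> k) * (G x k j - G y k j)) *\<^sub>R j)"
      using elim(2) x
      by (simp add: flat_def G_w right_diff_distrib sum_subtractf scaleR_diff_left)
    also have "norm \<dots> \<le> (\<Sum>j\<in>Basis. \<Sum>k\<in>Basis. norm w * \<bar>G y k j - G x k j\<bar>)"
      apply (rule sum_norm_le)
      apply simp
      apply (rule sum_abs[THEN order_trans])
      apply (rule sum_mono)
      by (auto simp: abs_mult abs_minus_commute intro!: mult_mono Basis_le_norm)
    also have "\<dots> = \<epsilon> y * norm w"
      by (simp add: \<epsilon>_def sum_distrib_left mult.commute[of _ "norm w"])
    also have "\<dots> \<le> B / 2 * norm w"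
      using elim(1) by (intro mult_right_mono) auto
    finally have "norm (flat x w) \<le> B / 2 * norm w + 1"
      using i \<open>flat y w = i\<close> norm_triangle_sub[of "flat x w" i] by simp
    then have "B * norm w \<le> B / 2 * norm w + 1" using B(2)[of w] by linarith
    then show ?case unfolding w_def[symmetric] using B(1) by (simp add: field_simps)
  qed
  then show ?thesis by blast
qed

text \<open>In the resolvent identity the entries at \<open>y\<close> stay bounded while the
  differences of \<open>G\<close> tend to zero.\<close>

lemma isCont_h:
  assumes x: "x \<in> S" and i: "i \<in> Basis" and j: "j \<in> Basis"
  shows "isCont (\<lambda>y. h y i j) x"
proof -
  obtain K where K: "\<forall>\<^sub>F y in at x. norm (sharp G y (\<lambda>z. z \<bullet> i)) \<le> K"
    using sharp_coord_locally_bounded[OF x i] by blast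
  have "((\<lambda>y. h y i j - h x i j) \<longlongrightarrow> 0) (at x)"
  proof (rule Lim_null_comparison)
    have "\<forall>\<^sub>F y in at x. y \<in> S"
      using eventually_at_in_open'[OF open_S x] .
    with K show "\<forall>\<^sub>F y in at x. norm (h y i j - h x i j) \<le>
        (\<Sum>k\<in>Basis. \<Sum>l\<in>Basis. K * \<bar>h x j l\<bar> * \<bar>G y k l - G x k l\<bar>)"
    proof eventually_elim
      case (elim y)
      have "\<bar>h y i k\<bar> \<le> K" if "k \<in> Basis" for k
        using elim(1) Basis_le_norm[OF that, of "sharp G y (\<lambda>z. z \<bullet> i)"]
        unfolding inv_met_def by linarith
      then show ?case
        unfolding h_difference[OF x elim(2)] norm_minus_cancel
        by (intro sum_norm_le) (auto simp: abs_mult intro!: mult_right_mono)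
    qed
    have "((\<lambda>y. \<Sum>k\<in>Basis. \<Sum>l\<in>Basis. K * \<bar>h x j l\<bar> * \<bar>G y k l - G x k l\<bar>) \<longlongrightarrow>
        (\<Sum>k\<in>(Basis::'a set). \<Sum>l\<in>Basis. K * \<bar>h x j l\<bar> * \<bar>G x k l - G x k l\<bar>)) (at x)"
      by (intro tendsto_intros G_tendsto x)
    then show "((\<lambda>y. \<Sum>k\<in>Basis. \<Sum>l\<in>Basis. K * \<bar>h x j l\<bar> * \<bar>G y k l - G x k l\<bar>) \<longlongrightarrow> 0) (at x)"
      by simp
  qed
  then show ?thesis
    unfolding isCont_def using Lim_null by blast
qed

text \<open>The resolvent identity is exact, and each of its terms is a continuous entry of the
  inverse times a differentiable function vanishing at \<open>x\<close>.\<close>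

lemma has_derivative_h:
  assumes x: "x \<in> S" and i: "i \<in> Basis" and j: "j \<in> Basis"
  shows "((\<lambda>y. h y i j) has_derivative
    (\<lambda>v. - (\<Sum>k\<in>Basis. \<Sum>l\<in>Basis. h x i k * (h x j l * dir_deriv (\<lambda>y. G y k l) x v)))) (at x)"
proof (rule has_derivative_transform_within_open[OF _ open_S x])
  have D: "((\<lambda>y. h y i k * (h x j l * (G y k l - G x k l))) has_derivative
      (\<lambda>v. h x i k * (h x j l * dir_deriv (\<lambda>y. G y k l) x v))) (at x)" if "k \<in> Basis" for k l
    using has_derivative_dir_deriv[OF diff_G[OF x, of k l]]
    by (intro has_derivative_mult_vanishing isCont_h x i that)
      (auto intro!: derivative_eq_intros)
  have "((\<lambda>y. h x i j - (\<Sum>k\<in>Basis. \<Sum>l\<in>Basis. h y i k * (h x j l * (G y k l - G x k l))))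
      has_derivative (\<lambda>v. 0 - (\<Sum>k\<in>Basis. \<Sum>l\<in>Basis. h x i k *
        (h x j l * dir_deriv (\<lambda>y. G y k l) x v)))) (at x)"
    by (intro has_derivative_diff has_derivative_const has_derivative_sum D)
  then show "((\<lambda>y. h x i j - (\<Sum>k\<in>Basis. \<Sum>l\<in>Basis. h y i k * (h x j l * (G y k l - G x k l))))
      has_derivative (\<lambda>v. - (\<Sum>k\<in>Basis. \<Sum>l\<in>Basis. h x i k *
        (h x j l * dir_deriv (\<lambda>y. G y k l) x v)))) (at x)"
    by simp
  show "h x i j - (\<Sum>k\<in>Basis. \<Sum>l\<in>Basis. h y i k * (h x j l * (G y k l - G x k l))) = h y i j"
    if "y \<in> S" for y
    using h_difference[OF x that, of i j] by (simp add: mult.assoc)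
qed

text \<open>Bootstrapping: the derivative of \<open>h\<close> is a polynomial in entries of
  \<open>h\<close> and derivatives of \<open>G\<close>, so order \<open>k\<close> for all entries
  gives order \<open>k + 1\<close> for all entries.\<close>

lemma smooth_h:
  assumes "i \<in> Basis" "j \<in> Basis"
  shows "smooth_on (\<lambda>x. h x i j) S"
proof -
  have "\<forall>i\<in>Basis. \<forall>j\<in>Basis. Ck_on k (\<lambda>x. h x i j) S" for k
  proof (induction k)
    case 0
    then show ?case using isCont_h by (auto intro!: continuous_at_imp_continuous_on)
  next
    case (Suc k)
    have G: "Ck_on k (\<lambda>x. dir_deriv (\<lambda>y. G y u w) x v) S" for u w v
      using smooth_on_dir_deriv[OF smooth_G] unfolding smooth_on_def by blast
    show ?case
    proof (intro ballI)
      fix i j :: 'a assume ij: "i \<in> Basis" "j \<in> Basis"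
      have "Ck_on k (\<lambda>x. dir_deriv (\<lambda>x. h x i j) x v) S" for v
      proof (rule Ck_on_cong[OF open_S])
        show "Ck_on k (\<lambda>x. (-1) * (\<Sum>k\<in>Basis. \<Sum>l\<in>Basis. h x i k *
            (h x j l * dir_deriv (\<lambda>y. G y k l) x v))) S"
          by (intro Ck_on_bilinear[OF open_S bounded_bilinear_mult] Ck_on_sum open_S Ck_on_const G)
            (use Suc.IH ij in auto)
        show "(-1) * (\<Sum>k\<in>Basis. \<Sum>l\<in>Basis. h x i k * (h x j l * dir_deriv (\<lambda>y. G y k l) x v))
          = dir_deriv (\<lambda>x. h x i j) x v" if "x \<in> S" for x
          using dir_deriv_eqI[OF has_derivative_h[OF that ij]] by simp
      qed
      then show "Ck_on (Suc k) (\<lambda>x. h x i j) S"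
        using has_derivative_h[OF _ ij] by (auto simp: differentiable_def)
    qed
  qed
  then show ?thesis using assms by (simp add: smooth_on_def)
qed

section \<open>Christoffel symbols\<close>

context
  fixes x assumes x: "x \<in> S"
begin

lemma dG_sym: "dir_deriv (\<lambda>y. G y u v) x e = dir_deriv (\<lambda>y. G y v u) x e"
  by (rule dir_deriv_cong[OF open_S x]) (rule sym_G)

lemma dG_add: "dir_deriv (\<lambda>y. G y u (v + w)) x e =
    dir_deriv (\<lambda>y. G y u v) x e + dir_deriv (\<lambda>y. G y u w) x e"
  using dir_deriv_cong[OF open_S x, of "\<lambda>y. G y u (v + w)" "\<lambda>y. G y u v + G y u w"] x
  by (simp add: G_simps dir_deriv_add diff_G)

lemma dG_scale: "dir_deriv (\<lambda>y. G y u (c *\<^sub>R v)) x e = c * dir_deriv (\<lambda>y. G y u v) x e"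
  using dir_deriv_cong[OF open_S x, of "\<lambda>y. G y u (c *\<^sub>R v)" "\<lambda>y. c * G y u v"] x
  by (simp add: G_simps dir_deriv_cmult diff_G)

lemma dG_linear: "linear (dir_deriv (\<lambda>y. G y u v) x)"
  by (rule linear_dir_deriv[OF diff_G[OF x]])

text \<open>Linearity makes the covector in the definition of \<open>christoffel\<close>
  representable, so that \<open>G_sharp\<close> yields the Koszul formula.\<close>

lemma linear_koszul: "linear (\<lambda>z. 1/2 * (dir_deriv (\<lambda>y. G y v z) x u +
    dir_deriv (\<lambda>y. G y u z) x v - dir_deriv (\<lambda>y. G y u v) x z))"
  by (rule linearI)
    (simp_all add: dG_add dG_scale linear_add[OF dG_linear] linear_scale[OF dG_linear] algebra_simps)

lemma G_christoffel: "G x (\<Gamma> x u v) z = 1/2 * (dir_deriv (\<lambda>y. G y v z) x u +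
    dir_deriv (\<lambda>y. G y u z) x v - dir_deriv (\<lambda>y. G y u v) x z)"
  unfolding christoffel_def by (rule G_sharp[OF x linear_koszul])

lemma christoffel_sym: "\<Gamma> x u v = \<Gamma> x v u"
  by (rule G_eq_iff[OF x]) (simp add: G_christoffel dG_sym[of u v])

lemma christoffel_add: "\<Gamma> x u (v + w) = \<Gamma> x u v + \<Gamma> x u w"
  by (rule G_eq_iff[OF x])
    (simp add: G_christoffel G_simps[OF x] dG_add linear_add[OF dG_linear] dG_sym[of "v + w"]
      dG_sym[of v] dG_sym[of w] algebra_simps)

lemma christoffel_scale: "\<Gamma> x u (c *\<^sub>R v) = c *\<^sub>R \<Gamma> x u v"
  by (rule G_eq_iff[OF x])
    (simp add: G_christoffel G_simps[OF x] dG_scale linear_scale[OF dG_linear] dG_sym[of "c *\<^sub>R v"]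
      dG_sym[of v] algebra_simps)

lemma linear_christoffel: "linear (\<Gamma> x u)"
  by (rule linearI) (simp_all add: christoffel_add christoffel_scale)

lemma christoffel_zero: "\<Gamma> x 0 v = 0" "\<Gamma> x v 0 = 0"
  using christoffel_sym[of 0 v] linear_0[OF linear_christoffel] by auto

text \<open>In the sum of the two Koszul formulas all derivatives cancel except twice the one along
  \<open>e\<close>.\<close>

lemma metric_compatible:
  "dir_deriv (\<lambda>y. G y u v) x e = G x (\<Gamma> x e u) v + G x u (\<Gamma> x e v)"
  unfolding sym_G[OF x, of u "\<Gamma> x e v"]
  by (simp add: G_christoffel dG_sym[of v u] dG_sym[of v e] dG_sym[of u e] field_simps)

end

lemma smooth_christoffel: "smooth_on (\<lambda>x. \<Gamma> x u v) S"
proof (rule smooth_on_cong[OF open_S])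
  show "smooth_on (\<lambda>x. \<Sum>i\<in>Basis. \<Sum>j\<in>Basis. (1/2 * (dir_deriv (\<lambda>y. G y v i) x u +
      dir_deriv (\<lambda>y. G y u i) x v - dir_deriv (\<lambda>y. G y u v) x i) * h x i j) *\<^sub>R j) S"
    by (intro smooth_intros open_S smooth_h smooth_G)
  show "(\<Sum>i\<in>Basis. \<Sum>j\<in>Basis. (1/2 * (dir_deriv (\<lambda>y. G y v i) x u +
      dir_deriv (\<lambda>y. G y u i) x v - dir_deriv (\<lambda>y. G y u v) x i) * h x i j) *\<^sub>R j) = \<Gamma> x u v"
    if "x \<in> S" for x
    unfolding christoffel_def by (rule sharp_linear[OF that linear_koszul[OF that], symmetric])
qed

text \<open>The argument varies with the point; expanding it in the basis leaves smooth coefficients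
  times Christoffel symbols of constant vectors.\<close>

lemma smooth_christoffel_field:
  assumes "smooth_on X S"
  shows "smooth_on (\<lambda>x. \<Gamma> x u (X x)) S"
proof (rule smooth_on_cong[OF open_S])
  show "smooth_on (\<lambda>x. \<Sum>k\<in>Basis. (X x \<bullet> k) *\<^sub>R \<Gamma> x u k) S"
    by (intro smooth_intros open_S smooth_christoffel assms)
  show "(\<Sum>k\<in>Basis. (X x \<bullet> k) *\<^sub>R \<Gamma> x u k) = \<Gamma> x u (X x)" if "x \<in> S" for x
    using linear_sum[OF linear_christoffel[OF that, of u], of "\<lambda>k. (X x \<bullet> k) *\<^sub>R k" Basis, symmetric]
    by (simp add: christoffel_scale[OF that] euclidean_representation)
qed

lemma smooth_G_field:
  assumes "smooth_on X S"
  shows "smooth_on (\<lambda>x. G x (X x) v) S"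
proof (rule smooth_on_cong[OF open_S])
  show "smooth_on (\<lambda>x. \<Sum>k\<in>Basis. (X x \<bullet> k) * G x k v) S"
    by (intro smooth_intros open_S smooth_G assms)
  show "(\<Sum>k\<in>Basis. (X x \<bullet> k) * G x k v) = G x (X x) v" if "x \<in> S" for x
    using G_sum(1)[OF that, of "\<lambda>k. (X x \<bullet> k) *\<^sub>R k" Basis v]
    by (simp add: G_simps[OF that] euclidean_representation)
qed

section \<open>Curvature tensor in a chart\<close>

lemma curvature_const:
  assumes "x \<in> S"
  shows "curvature G (\<lambda>_. u) (\<lambda>_. v) (\<lambda>_. w) x =
    dir_deriv (\<lambda>y. \<Gamma> y u w) x v + \<Gamma> x v (\<Gamma> x u w) - (dir_deriv (\<lambda>y. \<Gamma> y v w) x u + \<Gamma> x u (\<Gamma> x v w))"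
  unfolding curvature_def nabla_def lie_bracket_def by (simp add: christoffel_zero[OF assms])

lemma riemann_eq:
  assumes "x \<in> S"
  shows "riemann G x u v w z =
    G x (dir_deriv (\<lambda>y. \<Gamma> y u w) x v + \<Gamma> x v (\<Gamma> x u w) -
      (dir_deriv (\<lambda>y. \<Gamma> y v w) x u + \<Gamma> x u (\<Gamma> x v w))) z"
  unfolding riemann_def curvature_const[OF assms] ..

lemma smooth_riemann: "smooth_on (\<lambda>x. riemann G x u v w z) S"
proof (rule smooth_on_cong[OF open_S riemann_eq[symmetric]])
  show "smooth_on (\<lambda>x. G x (dir_deriv (\<lambda>y. \<Gamma> y u w) x v + \<Gamma> x v (\<Gamma> x u w) -
      (dir_deriv (\<lambda>y. \<Gamma> y v w) x u + \<Gamma> x u (\<Gamma> x v w))) z) S"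
    by (intro smooth_G_field smooth_intros open_S smooth_christoffel smooth_christoffel_field)
qed

lemma smooth_scalar_curv: "smooth_on (scalar_curv G) S"
  unfolding scalar_curv_def[abs_def] ricci_def
  by (intro smooth_intros open_S smooth_h smooth_riemann)

lemma riemann_antisym: "x \<in> S \<Longrightarrow> riemann G x v u w z = - riemann G x u v w z"
  by (simp add: riemann_eq G_simps)

text \<open>The space-time connection sends \<open>\<partial>\<^sub>t\<close> to \<open>q t\<close>
  times a spatial vector, and this factor has to be pulled out of the first slot. The case
  \<open>c = 0\<close> also starts \<open>riemann_zero\<close>.\<close>

lemma riemann_scale1:
  assumes x: "x \<in> S"
  shows "riemann G x (c *\<^sub>R u) v w z = c * riemann G x u v w z"
proof -
  have \<Gamma>: "\<Gamma> y (c *\<^sub>R u) v = c *\<^sub>R \<Gamma> y u v" if "y \<in> S" for y v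
    using that christoffel_scale[of y v c u] by (simp add: christoffel_sym[of y _ v])
  have "dir_deriv (\<lambda>y. \<Gamma> y (c *\<^sub>R u) w) x v = c *\<^sub>R dir_deriv (\<lambda>y. \<Gamma> y u w) x v"
    using dir_deriv_cong[OF open_S x, of "\<lambda>y. \<Gamma> y (c *\<^sub>R u) w" "\<lambda>y. c *\<^sub>R \<Gamma> y u w"]
      smooth_on_differentiable[OF smooth_christoffel x]
    by (simp add: \<Gamma> dir_deriv_scaleR)
  moreover have "dir_deriv (\<lambda>y. \<Gamma> y v w) x (c *\<^sub>R u) = c *\<^sub>R dir_deriv (\<lambda>y. \<Gamma> y v w) x u"
    by (rule linear_scale[OF linear_dir_deriv[OF smooth_on_differentiable[OF smooth_christoffel x]]])
  ultimately show ?thesis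
    using x by (simp add: riemann_eq \<Gamma> christoffel_scale G_simps algebra_simps)
qed

lemma riemann_zero:
  assumes x: "x \<in> S"
  shows "riemann G x 0 v w z = 0" "riemann G x u 0 w z = 0" "riemann G x u v 0 z = 0"
    "riemann G x u v w 0 = 0"
proof -
  have "dir_deriv (\<lambda>y. \<Gamma> y u 0) x v = 0" for u v
    using dir_deriv_cong[OF open_S x, of "\<lambda>y. \<Gamma> y u 0" "\<lambda>_. 0"] by (simp add: christoffel_zero)
  then show "riemann G x u v 0 z = 0"
    by (simp add: riemann_eq x christoffel_zero G_simps)
qed (use riemann_scale1[OF x, of 0 0] riemann_antisym[OF x, of 0 u] in
  \<open>auto simp: riemann_eq[of x u v w 0] G_simps x\<close>)

text \<open>In the present sign convention, the curvature tensor of a metric of constant curvature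
  one.\<close>

definition wedge :: "'a \<Rightarrow> 'a \<Rightarrow> 'a \<Rightarrow> 'a \<Rightarrow> 'a \<Rightarrow> real" where
  "wedge x u v w z = G x u w * G x v z - G x v w * G x u z"

text \<open>The tensor \<open>wedge\<close> is built from the metric and hence parallel, so beside
  the derivative of \<open>riemann\<close> only that of the coefficient \<open>s\<close> remains. It
  applies to the spatial slices of the space-time tensor and to the concircular tensor of
  \<open>M\<close>.\<close>

lemma cov_deriv4_riemann_wedge:
  assumes x: "x \<in> S" and s: "s differentiable at x"
    and T: "\<And>y u v w z. y \<in> S \<Longrightarrow> T y u v w z = c * riemann G y u v w z + s y * wedge y u v w z"
  shows "cov_deriv4 G T x e u v w z =
    c * cov_deriv4 G (riemann G) x e u v w z + dir_deriv s x e * wedge x u v w z"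
proof -
  note R = smooth_on_differentiable[OF smooth_riemann x]
  have "dir_deriv (\<lambda>y. T y u v w z) x e =
      dir_deriv (\<lambda>y. c * riemann G y u v w z + s y * wedge y u v w z) x e"
    by (rule dir_deriv_cong[OF open_S x T])
  also have "\<dots> = c * dir_deriv (\<lambda>y. riemann G y u v w z) x e + dir_deriv s x e * wedge x u v w z +
    s x * (dir_deriv (\<lambda>y. G y u w) x e * G x v z + G x u w * dir_deriv (\<lambda>y. G y v z) x e
     - dir_deriv (\<lambda>y. G y v w) x e * G x u z - G x v w * dir_deriv (\<lambda>y. G y u z) x e)"
    unfolding wedge_def
    by (rule dir_deriv_eqI)
      (auto intro!: derivative_eq_intros has_derivative_dir_deriv s R diff_G[OF x] simp: algebra_simps)
  finally show ?thesis
    unfolding cov_deriv4_def T[OF x] metric_compatible[OF x] by (simp add: wedge_def algebra_simps)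
qed

end

section \<open>Warped products\<close>

lemma dir_deriv_slice_snd:
  assumes "H differentiable at (t, x)"
  shows "dir_deriv H (t, x) (0, e) = dir_deriv (\<lambda>y. H (t, y)) x e"
proof (rule dir_deriv_eqI[symmetric])
  show "((\<lambda>y. H (t, y)) has_derivative (\<lambda>e. dir_deriv H (t, x) (0, e))) (at x)"
    by (rule has_derivative_compose[of "Pair t" _ x UNIV H])
      (auto intro!: derivative_eq_intros has_derivative_dir_deriv assms)
qed

lemma dir_deriv_slice_fst:
  assumes "H differentiable at (t, x)"
  shows "dir_deriv H (t, x) (a, 0) = dir_deriv (\<lambda>s. H (s, x)) t a"
proof (rule dir_deriv_eqI[symmetric])
  show "((\<lambda>s. H (s, x)) has_derivative (\<lambda>a. dir_deriv H (t, x) (a, 0))) (at t)"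
    by (rule has_derivative_compose[of "\<lambda>s. (s, x)" _ t UNIV H])
      (auto intro!: derivative_eq_intros has_derivative_dir_deriv assms)
qed

text \<open>The metric and the Christoffel symbols of the space-time are sums of terms of this form,
  a function of time times a function of position.\<close>

lemma has_derivative_separated:
  fixes \<phi> :: "real \<Rightarrow> real"
  assumes "(\<phi> has_real_derivative \<phi>') (at t)" "\<psi> differentiable at x"
  shows "((\<lambda>y. \<phi> (fst y) *\<^sub>R \<psi> (snd y)) has_derivative
    (\<lambda>v. (\<phi>' * fst v) *\<^sub>R \<psi> x + \<phi> t *\<^sub>R dir_deriv \<psi> x (snd v))) (at (t, x))"
proof -
  have "(\<phi> has_derivative (*) \<phi>') (at (fst (t, x)))"
    using assms(1) by (simp add: has_field_derivative_def)
  from has_derivative_compose[OF has_derivative_fst[OF has_derivative_ident] this]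
  have 1: "((\<lambda>y. \<phi> (fst y)) has_derivative (\<lambda>v. \<phi>' * fst v)) (at (t, x))" .
  have "(\<psi> has_derivative dir_deriv \<psi> x) (at (snd (t, x)))"
    using has_derivative_dir_deriv[OF assms(2)] by simp
  from has_derivative_compose[OF has_derivative_snd[OF has_derivative_ident] this]
  have 2: "((\<lambda>y. \<psi> (snd y)) has_derivative (\<lambda>v. dir_deriv \<psi> x (snd v))) (at (t, x))" .
  show ?thesis
    using has_derivative_scaleR[OF 1 2] by (simp add: add.commute)
qed

lemma differentiable_separated:
  fixes \<phi> :: "real \<Rightarrow> real"
  assumes "\<phi> differentiable at t" "\<psi> differentiable at x"
  shows "(\<lambda>y. \<phi> (fst y) *\<^sub>R \<psi> (snd y)) differentiable at (t, x)"
proof -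
  obtain \<phi>' where "(\<phi> has_real_derivative \<phi>') (at t)"
    using assms(1) real_differentiable_def by blast
  from has_derivative_separated[OF this assms(2)] show ?thesis
    unfolding differentiable_def by blast
qed

text \<open>
  In terms of the warping function \<open>f\<close>, \<open>F = f\<^sup>2\<close>, \<open>q = f' / f\<close> and \<open>p = q'\<close>: with these
  parameters the connection and the curvature are polynomial.
\<close>

locale warped = chart_metric S G for S :: "'a::euclidean_space set" and G +
  fixes I :: "real set" and F q p :: "real \<Rightarrow> real"
  assumes open_I: "open I"
    and F_pos: "t \<in> I \<Longrightarrow> F t > 0"
    and deriv_F: "t \<in> I \<Longrightarrow> (F has_real_derivative 2 * q t * F t) (at t)"
    and deriv_q: "t \<in> I \<Longrightarrow> (q has_real_derivative p t) (at t)"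
    and diff_p: "t \<in> I \<Longrightarrow> p differentiable at t"
begin

definition Gb :: "(real \<times> 'a) met" where
  "Gb = (\<lambda>(t, x) (r, u) (s, v). - (r * s) + F t * G x u v)"

lemma Gb_apply [simp]: "Gb (t, x) (r, u) (s, v) = - (r * s) + F t * G x u v"
  by (simp add: Gb_def)

lemma open_IS: "open (I \<times> S)"
  by (intro open_Times open_I open_S)

section \<open>Inverse metric and connection of the space-time\<close>

context
  fixes t x assumes t: "t \<in> I" and x: "x \<in> S"
begin

lemma tx: "(t, x) \<in> I \<times> S" using t x by simp

lemma F_nonzero [simp]: "F t \<noteq> 0" using F_pos[OF t] by simp

text \<open>Nondegeneracy of the warped metric: spatial test vectors determine the spatial part,
  since \<open>F t\<close> is nonzero and \<open>G x\<close> nondegenerate, and the vector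
  \<open>(1, 0)\<close> determines the time part.\<close>

lemma sharp_Gb_eqI:
  assumes "\<And>z. Gb (t, x) w z = \<alpha> z"
  shows "sharp Gb (t, x) \<alpha> = w"
  unfolding sharp_def
proof (rule the_equality)
  fix w' assume w': "\<forall>z. Gb (t, x) w' z = \<alpha> z"
  have eq: "Gb (t, x) w' (s, v) = Gb (t, x) w (s, v)" for s v using assms w' by metis
  obtain r u r' u' where w: "w = (r, u)" "w' = (r', u')" by fastforce
  have "G x u' v = G x u v" for v using eq[of 0 v] w by simp
  moreover have "r' = r" using eq[of 1 0] w by (simp add: G_simps[OF x])
  ultimately show "w' = w" using w G_eq_iff[OF x] by simp
qed (use assms in auto)

lemma inv_met_Gb:
  "inv_met Gb (t, x) (1, 0) (1, 0) = -1" "inv_met Gb (t, x) (1, 0) (0, j) = 0"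
  "inv_met Gb (t, x) (0, j) (1, 0) = 0" "inv_met Gb (t, x) (0, i) (0, j) = h x i j / F t"
proof -
  have "sharp Gb (t, x) (\<lambda>z. z \<bullet> (1, 0)) = (-1, 0)"
    by (rule sharp_Gb_eqI) (auto simp: G_simps[OF x])
  moreover have "sharp Gb (t, x) (\<lambda>z. z \<bullet> (0, i)) = (0, (1 / F t) *\<^sub>R sharp G x (\<lambda>z. z \<bullet> i))" for i
    by (rule sharp_Gb_eqI) (auto simp: G_simps[OF x] G_sharp_coord[OF x])
  ultimately show "inv_met Gb (t, x) (1, 0) (1, 0) = -1" "inv_met Gb (t, x) (1, 0) (0, j) = 0"
    "inv_met Gb (t, x) (0, j) (1, 0) = 0" "inv_met Gb (t, x) (0, i) (0, j) = h x i j / F t"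
    by (simp_all add: inv_met_def)
qed

text \<open>The inverse metric is block diagonal, with \<open>-1\<close> for time and
  \<open>h / F\<close> for space.\<close>

lemma trace_Gb:
  "(\<Sum>i\<in>Basis. \<Sum>j\<in>Basis. inv_met Gb (t, x) i j * T i j) =
    - T (1, 0) (1, 0) + (\<Sum>i\<in>Basis. \<Sum>j\<in>Basis. h x i j * T (0, i) (0, j)) / F t"
proof -
  have split: "(\<Sum>i\<in>Basis. g i) = g (1, 0) + (\<Sum>i\<in>Basis. g (0, i))" for g :: "real \<times> 'a \<Rightarrow> real"
  proof -
    have "inj_on (\<lambda>u. (u::real, 0::'a)) Basis" "inj_on (\<lambda>u. (0::real, u::'a)) Basis"
      by (auto intro!: inj_onI)
    then show ?thesis
      unfolding Basis_prod_def by (subst sum.union_disjoint) (auto simp: sum.reindex)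
  qed
  show ?thesis
    unfolding split by (simp add: inv_met_Gb sum_divide_distrib)
qed

lemma has_derivative_Gb:
  "((\<lambda>y. Gb y (r, u) (s, v)) has_derivative
    (\<lambda>d. 2 * q t * F t * fst d * G x u v + F t * dir_deriv (\<lambda>y. G y u v) x (snd d))) (at (t, x))"
proof -
  have "(\<lambda>y. Gb y (r, u) (s, v)) = (\<lambda>y. - (r * s) + F (fst y) *\<^sub>R G (snd y) u v)"
    by (auto simp: fun_eq_iff)
  then show ?thesis
    using has_derivative_add[OF has_derivative_const[of "- (r * s)"]
        has_derivative_separated[OF deriv_F[OF t] diff_G[OF x, of u v]]]
    by simp
qed

lemma dir_deriv_Gb:
  "dir_deriv (\<lambda>y. Gb y (r, u) (s, v)) (t, x) (a, e) =
    2 * q t * F t * a * G x u v + F t * dir_deriv (\<lambda>y. G y u v) x e"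
  using dir_deriv_eqI[OF has_derivative_Gb, of r u s v "(a, e)"] by simp

text \<open>The known warped product connection, checked against the Koszul formula. The time part
  has a positive sign because the metric is negative on \<open>\<partial>\<^sub>t\<close>.\<close>

lemma christoffel_Gb:
  "christoffel Gb (t, x) (r, u) (s, v) =
    (q t * F t * G x u v, \<Gamma> x u v + q t *\<^sub>R (r *\<^sub>R v + s *\<^sub>R u))"
  unfolding christoffel_def[of Gb]
proof (rule sharp_Gb_eqI)
  fix z :: "real \<times> 'a"
  obtain d w where z: "z = (d, w)" by fastforce
  show "Gb (t, x) (q t * F t * G x u v, \<Gamma> x u v + q t *\<^sub>R (r *\<^sub>R v + s *\<^sub>R u)) z =
      1/2 * (dir_deriv (\<lambda>y. Gb y (s, v) z) (t, x) (r, u) + dir_deriv (\<lambda>y. Gb y (r, u) z) (t, x) (s, v)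
        - dir_deriv (\<lambda>y. Gb y (r, u) (s, v)) (t, x) z)"
    unfolding z dir_deriv_Gb Gb_apply
    by (simp add: G_simps[OF x] G_christoffel[OF x] field_simps)
qed

end

section \<open>Curvature tensor and its traces on the space-time\<close>

lemma dir_deriv_christoffel_Gb:
  assumes t: "t \<in> I" and x: "x \<in> S"
  shows "dir_deriv (\<lambda>y. christoffel Gb y (a, u) (c, w)) (t, x) (b, v) =
    ((p t + 2 * (q t)\<^sup>2) * F t * b * G x u w + q t * F t * (G x (\<Gamma> x v u) w + G x u (\<Gamma> x v w)),
     dir_deriv (\<lambda>y. \<Gamma> y u w) x v + (b * p t) *\<^sub>R (a *\<^sub>R w + c *\<^sub>R u))"
proof -
  \<comment> \<open>The factor \<open>1 *\<^sub>R\<close> brings the middle summand into the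
    separated form as well.\<close>
  have "dir_deriv (\<lambda>y. christoffel Gb y (a, u) (c, w)) (t, x) (b, v) =
    dir_deriv (\<lambda>y. ((q (fst y) * F (fst y)) *\<^sub>R G (snd y) u w,
      1 *\<^sub>R \<Gamma> (snd y) u w + q (fst y) *\<^sub>R (a *\<^sub>R w + c *\<^sub>R u))) (t, x) (b, v)"
    by (rule dir_deriv_cong[OF open_IS]) (use t x in \<open>auto simp: christoffel_Gb\<close>)
  also have "\<dots> = ((q t * (2 * q t * F t) + p t * F t) * b * G x u w
      + q t * F t * dir_deriv (\<lambda>y. G y u w) x v,
     dir_deriv (\<lambda>y. \<Gamma> y u w) x v + (p t * b) *\<^sub>R (a *\<^sub>R w + c *\<^sub>R u))"
    apply (subst dir_deriv_eqI[OF has_derivative_Pair[OF has_derivative_separated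
        has_derivative_add[OF has_derivative_separated has_derivative_separated]]])
    apply (rule DERIV_mult'[OF deriv_q[OF t] deriv_F[OF t]])
    apply (rule diff_G[OF x])
    apply (rule DERIV_const)
    apply (rule smooth_on_differentiable[OF smooth_christoffel x])
    apply (rule deriv_q[OF t])
    apply (rule differentiable_const)
    apply simp
    done
  finally show ?thesis
    by (simp add: metric_compatible[OF x] algebra_simps power2_eq_square)
qed

text \<open>Planes containing \<open>\<partial>\<^sub>t\<close> see \<open>p + q\<^sup>2\<close>,
  which is \<open>f'' / f\<close>, while spatial planes see the curvature of \<open>M\<close>
  corrected by \<open>q\<^sup>2 * F\<close>.\<close>

lemma curvature_Gb:
  assumes t: "t \<in> I" and x: "x \<in> S"
  shows "curvature Gb (\<lambda>_. (a, u)) (\<lambda>_. (b, v)) (\<lambda>_. (c, w)) (t, x) =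
    (F t * (p t + (q t)\<^sup>2) * (b * G x u w - a * G x v w),
     curvature G (\<lambda>_. u) (\<lambda>_. v) (\<lambda>_. w) x + ((q t)\<^sup>2 * F t) *\<^sub>R (G x u w *\<^sub>R v - G x v w *\<^sub>R u)
       - (p t + (q t)\<^sup>2) *\<^sub>R ((a * c) *\<^sub>R v - (b * c) *\<^sub>R u))"
proof -
  have "christoffel Gb (t, x) 0 (c, w) = 0"
    using christoffel_Gb[OF t x, of 0 0 c w] by (simp add: zero_prod_def christoffel_zero[OF x] G_simps[OF x])
  then have "curvature Gb (\<lambda>_. (a, u)) (\<lambda>_. (b, v)) (\<lambda>_. (c, w)) (t, x) =
    dir_deriv (\<lambda>y. christoffel Gb y (a, u) (c, w)) (t, x) (b, v)
      + christoffel Gb (t, x) (b, v) (christoffel Gb (t, x) (a, u) (c, w))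
    - (dir_deriv (\<lambda>y. christoffel Gb y (b, v) (c, w)) (t, x) (a, u)
      + christoffel Gb (t, x) (a, u) (christoffel Gb (t, x) (b, v) (c, w)))"
    unfolding curvature_def nabla_def lie_bracket_def by simp
  then show ?thesis
    unfolding curvature_const[OF x] dir_deriv_christoffel_Gb[OF t x] christoffel_Gb[OF t x]
    by (simp add: G_simps[OF x] christoffel_add[OF x] christoffel_scale[OF x]
        christoffel_sym[OF x, of v u] sym_G[OF x, of v "\<Gamma> x u w"] sym_G[OF x, of u "\<Gamma> x v w"]
        sym_G[OF x, of v u] algebra_simps power2_eq_square)
qed

text \<open>The cross terms of the wedge formed with \<open>Gb\<close>: that wedge is
  \<open>(F t)\<^sup>2\<close> times \<open>wedge\<close> minus \<open>F t\<close> times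
  \<open>mixed\<close>, the products of four time entries cancelling.\<close>

definition mixed :: "'a \<Rightarrow> real \<Rightarrow> 'a \<Rightarrow> real \<Rightarrow> 'a \<Rightarrow> real \<Rightarrow> 'a \<Rightarrow> real \<Rightarrow> 'a \<Rightarrow> real" where
  "mixed x a u b v c w d z =
    a * c * G x v z - b * c * G x u z - a * d * G x v w + b * d * G x u w"

lemma riemann_Gb:
  assumes t: "t \<in> I" and x: "x \<in> S"
  shows "riemann Gb (t, x) (a, u) (b, v) (c, w) (d, z) = F t * riemann G x u v w z
    + (q t)\<^sup>2 * (F t)\<^sup>2 * wedge x u v w z - (p t + (q t)\<^sup>2) * F t * mixed x a u b v c w d z"
  unfolding riemann_def curvature_Gb[OF t x] Gb_apply wedge_def mixed_def
  by (simp add: G_simps[OF x] algebra_simps power2_eq_square)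

lemma trace_wedge:
  assumes x: "x \<in> S"
  shows "(\<Sum>i\<in>Basis. \<Sum>j\<in>Basis. h x i j * wedge x u i v j) = (real DIM('a) - 1) * G x u v"
proof -
  have "h x i j * wedge x u i v j = G x u v * (h x i j * G x i j) - h x i j * (G x v i * G x u j)" for i j
    by (simp add: wedge_def sym_G[OF x, of i v] algebra_simps)
  then have "(\<Sum>i\<in>Basis. \<Sum>j\<in>Basis. h x i j * wedge x u i v j) =
      G x u v * (\<Sum>i\<in>Basis. \<Sum>j\<in>Basis. h x i j * G x i j)
      - (\<Sum>i\<in>Basis. \<Sum>j\<in>Basis. h x i j * (G x v i * G x u j))"
    by (simp only: sum_subtractf sum_distrib_left)
  then show ?thesis
    using contract[OF x linear_G(1)[OF x, of u], of v] contract_G[OF x]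
    by (simp add: algebra_simps)
qed

text \<open>In terms of \<open>f\<close>, the first value is \<open>- n * f'' / f\<close> and the
  second adds \<open>f * f'' + (n - 1) * f'\<^sup>2\<close> times the metric, where \<open>n\<close>
  is the dimension of \<open>M\<close>.\<close>

lemma ricci_Gb:
  assumes t: "t \<in> I" and x: "x \<in> S"
  shows "ricci Gb (t, x) (1, 0) (1, 0) = - DIM('a) * (p t + (q t)\<^sup>2)"
    and "ricci Gb (t, x) (0, u) (0, v) = ricci G x u v
      + (p t + (q t)\<^sup>2 + (real DIM('a) - 1) * (q t)\<^sup>2) * F t * G x u v"
proof -
  note [simp] = riemann_zero[OF x] G_simps(9,10)[OF x]
  have "h x i j * riemann Gb (t, x) (1, 0) (0, i) (1, 0) (0, j) =
      - (p t + (q t)\<^sup>2) * F t * (h x i j * G x i j)" for i j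
    by (simp add: riemann_Gb[OF t x] wedge_def mixed_def algebra_simps)
  then have "(\<Sum>i\<in>Basis. \<Sum>j\<in>Basis. h x i j * riemann Gb (t, x) (1, 0) (0, i) (1, 0) (0, j)) =
      - (p t + (q t)\<^sup>2) * F t * DIM('a)"
    by (simp only: sum_distrib_left[symmetric] contract_G[OF x])
  then show "ricci Gb (t, x) (1, 0) (1, 0) = - DIM('a) * (p t + (q t)\<^sup>2)"
    using F_nonzero[OF t x]
    unfolding ricci_def[of Gb] trace_Gb[OF t x]
    by (simp add: riemann_Gb[OF t x] wedge_def mixed_def field_simps)
  have "h x i j * riemann Gb (t, x) (0, u) (0, i) (0, v) (0, j) =
      F t * (h x i j * riemann G x u i v j) + (q t)\<^sup>2 * (F t)\<^sup>2 * (h x i j * wedge x u i v j)" for i j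
    by (simp add: riemann_Gb[OF t x] mixed_def algebra_simps)
  then have "(\<Sum>i\<in>Basis. \<Sum>j\<in>Basis. h x i j * riemann Gb (t, x) (0, u) (0, i) (0, v) (0, j)) =
      F t * ricci G x u v + (q t)\<^sup>2 * (F t)\<^sup>2 * ((real DIM('a) - 1) * G x u v)"
    by (simp add: sum.distrib sum_distrib_left[symmetric] trace_wedge[OF x] ricci_def)
  then show "ricci Gb (t, x) (0, u) (0, v) = ricci G x u v
      + (p t + (q t)\<^sup>2 + (real DIM('a) - 1) * (q t)\<^sup>2) * F t * G x u v"
    using F_nonzero[OF t x]
    unfolding ricci_def[of Gb] trace_Gb[OF t x]
    by (simp add: riemann_Gb[OF t x] wedge_def mixed_def field_simps power2_eq_square)
qed

lemma scalar_curv_Gb: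
  assumes t: "t \<in> I" and x: "x \<in> S"
  shows "scalar_curv Gb (t, x) = scalar_curv G x / F t
    + (2 * DIM('a) * (p t + (q t)\<^sup>2) + DIM('a) * (real DIM('a) - 1) * (q t)\<^sup>2)"
proof -
  have "h x i j * ricci Gb (t, x) (0, i) (0, j) = h x i j * ricci G x i j
      + (p t + (q t)\<^sup>2 + (real DIM('a) - 1) * (q t)\<^sup>2) * F t * (h x i j * G x i j)" for i j
    by (simp add: ricci_Gb[OF t x] algebra_simps)
  then have "(\<Sum>i\<in>Basis. \<Sum>j\<in>Basis. h x i j * ricci Gb (t, x) (0, i) (0, j)) = scalar_curv G x
      + (p t + (q t)\<^sup>2 + (real DIM('a) - 1) * (q t)\<^sup>2) * F t * DIM('a)"
    by (simp add: sum.distrib sum_distrib_left[symmetric] scalar_curv_def contract_G[OF x])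
  then show ?thesis
    using F_nonzero[OF t x]
    unfolding scalar_curv_def[of Gb] trace_Gb[OF t x]
    by (simp add: ricci_Gb[OF t x] field_simps)
qed

section \<open>Concircular tensor of the space-time\<close>

definition \<kappa> :: "real \<Rightarrow> 'a \<Rightarrow> real" where
  "\<kappa> t x = scalar_curv Gb (t, x) / (DIM('a) * (real DIM('a) + 1))"

definition A :: "real \<Rightarrow> 'a \<Rightarrow> real" where
  "A t x = (\<kappa> t x - p t - (q t)\<^sup>2) * F t"

lemma concircular_Gb:
  assumes t: "t \<in> I" and x: "x \<in> S"
  shows "concircular Gb (t, x) (a, u) (b, v) (c, w) (d, z) = F t * riemann G x u v w z
    + ((q t)\<^sup>2 - \<kappa> t x) * (F t)\<^sup>2 * wedge x u v w z + A t x * mixed x a u b v c w d z"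
proof -
  have DIM: "real DIM(real \<times> 'a) * (real DIM(real \<times> 'a) - 1) = DIM('a) * (real DIM('a) + 1)"
    by simp
  show ?thesis
    unfolding concircular_def DIM \<kappa>_def[symmetric] riemann_Gb[OF t x] Gb_apply A_def
    by (simp add: wedge_def mixed_def algebra_simps power2_eq_square)
qed

text \<open>Time and position are separated here: the position enters only through the scalar
  curvature of \<open>M\<close>, so the spatial differential of \<open>\<kappa>\<close> is a
  multiple of that of \<open>scalar_curv G\<close>.\<close>

lemma kappa_eq:
  assumes t: "t \<in> I" and x: "x \<in> S"
  shows "\<kappa> t x = scalar_curv G x / (F t * (DIM('a) * (real DIM('a) + 1)))
    + (2 * (p t + (q t)\<^sup>2) + (real DIM('a) - 1) * (q t)\<^sup>2) / (real DIM('a) + 1)"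
proof -
  have "(\<tau> / c + (2 * n * P + n * (n - 1) * Q)) / (n * (n + 1)) =
      \<tau> / (c * (n * (n + 1))) + (2 * P + (n - 1) * Q) / (n + 1)" if "n > 0" "c > 0" for \<tau> c n P Q :: real
  proof -
    have "(2 * n * P + n * (n - 1) * Q) / (n * (n + 1)) = n * (2 * P + (n - 1) * Q) / (n * (n + 1))"
      by (simp add: algebra_simps)
    then show ?thesis using that by (simp add: add_divide_distrib)
  qed
  from this[OF _ F_pos[OF t], of "real DIM('a)"] show ?thesis
    unfolding \<kappa>_def scalar_curv_Gb[OF t x] by simp
qed

lemma diff_F: "t \<in> I \<Longrightarrow> F differentiable at t" and diff_q: "t \<in> I \<Longrightarrow> q differentiable at t"
  using deriv_F deriv_q real_differentiable_def by blast+

lemma differentiable_fst_comp: "\<phi> differentiable at t \<Longrightarrow> (\<lambda>y. \<phi> (fst y)) differentiable at (t, x)"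
  for \<phi> :: "real \<Rightarrow> real" and x :: 'a
  using differentiable_separated[of \<phi> t "\<lambda>_. 1::real" x] by simp

lemma differentiable_snd_comp: "\<psi> differentiable at x \<Longrightarrow> (\<lambda>y. \<psi> (snd y)) differentiable at (t, x)"
  for \<psi> :: "'a \<Rightarrow> real" and t :: real
  using differentiable_separated[of "\<lambda>_. 1" t \<psi> x] by simp

text \<open>Joint differentiability is what allows the partial derivatives of components to be
  computed on slices.\<close>

lemma differentiable_concircular_Gb:
  assumes t: "t \<in> I" and x: "x \<in> S"
  shows "(\<lambda>y. concircular Gb y U V W Z) differentiable at (t, x)"
proof -
  obtain a u b v c w d z where U: "U = (a, u)" "V = (b, v)" "W = (c, w)" "Z = (d, z)"
    by fastforce
  define N where "N = real DIM('a) * (real DIM('a) + 1)"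
  define k where "k y = scalar_curv G (snd y) / (F (fst y) * N)
    + (2 * (p (fst y) + (q (fst y))\<^sup>2) + (real DIM('a) - 1) * (q (fst y))\<^sup>2) / (real DIM('a) + 1)"
    for y :: "real \<times> 'a"
  have fst: "(\<lambda>y. F (fst y)) differentiable at (t, x)" "(\<lambda>y. q (fst y)) differentiable at (t, x)"
    "(\<lambda>y. p (fst y)) differentiable at (t, x)"
    by (intro differentiable_fst_comp diff_F diff_q diff_p t)+
  have snd: "(\<lambda>y. scalar_curv G (snd y)) differentiable at (t, x)"
    "(\<lambda>y. riemann G (snd y) u v w z) differentiable at (t, x)"
    "(\<lambda>y. G (snd y) u v) differentiable at (t, x)" for u v w z
    by (intro differentiable_snd_comp diff_G[OF x] smooth_on_differentiable[OF smooth_scalar_curv x]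
        smooth_on_differentiable[OF smooth_riemann x])+
  have N: "F (fst (t, x)) * N \<noteq> 0" "real DIM('a) + 1 \<noteq> 0"
    using F_nonzero[OF t x] by (simp_all add: N_def add_nonneg_eq_0_iff)
  have k: "k differentiable at (t, x)"
    unfolding k_def[abs_def]
    by (intro differentiable_add differentiable_divide differentiable_mult differentiable_power
        differentiable_const fst snd N)
  show ?thesis
  proof (rule differentiable_cong_open[OF open_IS tx[OF t x]])
    show "(\<lambda>y. F (fst y) * riemann G (snd y) u v w z
      + ((q (fst y))\<^sup>2 - k y) * (F (fst y))\<^sup>2 * wedge (snd y) u v w z
      + (k y - p (fst y) - (q (fst y))\<^sup>2) * F (fst y) * mixed (snd y) a u b v c w d z) differentiable at (t, x)"
      unfolding wedge_def mixed_def
      by (intro differentiable_add differentiable_diff differentiable_mult differentiable_power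
          differentiable_const fst snd k)
    show "F (fst y) * riemann G (snd y) u v w z
      + ((q (fst y))\<^sup>2 - k y) * (F (fst y))\<^sup>2 * wedge (snd y) u v w z
      + (k y - p (fst y) - (q (fst y))\<^sup>2) * F (fst y) * mixed (snd y) a u b v c w d z
      = concircular Gb y U V W Z" if "y \<in> I \<times> S" for y
      using that unfolding U by (auto simp: concircular_Gb kappa_eq k_def A_def N_def)
  qed
qed

lemma has_derivative_kappa:
  assumes t: "t \<in> I" and x: "x \<in> S"
  shows "((\<lambda>y. \<kappa> t y) has_derivative
    (\<lambda>e. dir_deriv (scalar_curv G) x e / (F t * (DIM('a) * (real DIM('a) + 1))))) (at x)"
proof (rule has_derivative_transform_within_open[OF _ open_S x kappa_eq[OF t, symmetric]])
  show "((\<lambda>x. scalar_curv G x / (F t * (DIM('a) * (real DIM('a) + 1)))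
    + (2 * (p t + (q t)\<^sup>2) + (real DIM('a) - 1) * (q t)\<^sup>2) / (real DIM('a) + 1)) has_derivative
    (\<lambda>e. dir_deriv (scalar_curv G) x e / (F t * (DIM('a) * (real DIM('a) + 1))))) (at x)"
    unfolding divide_inverse
    by (rule has_derivative_eq_rhs)
      (auto intro!: derivative_eq_intros has_derivative_dir_deriv
        smooth_on_differentiable[OF smooth_scalar_curv x])
qed

section \<open>Three components of the divergence\<close>

context
  fixes t x assumes t: "t \<in> I" and x: "x \<in> S"
begin

lemma zeros: "riemann G x 0 v w z = 0" "riemann G x u 0 w z = 0"
  "riemann G x u v 0 z = 0" "riemann G x u v w 0 = 0"
  "G x 0 v = 0" "G x v 0 = 0" "\<Gamma> x 0 v = 0" "\<Gamma> x v 0 = 0"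
  "wedge x 0 v w z = 0" "wedge x u 0 w z = 0" "wedge x u v 0 z = 0" "wedge x u v w 0 = 0"
  using riemann_zero[OF x] G_simps(9,10)[OF x] christoffel_zero[OF x] by (simp_all add: wedge_def)

text \<open>For components that vanish identically, such as those with exactly one time entry, only
  the Christoffel terms of the covariant derivative remain.\<close>

lemma dir_deriv_concircular_zero:
  assumes "\<And>s y. s \<in> I \<Longrightarrow> y \<in> S \<Longrightarrow> concircular Gb (s, y) U V W Z = 0"
  shows "dir_deriv (\<lambda>y. concircular Gb y U V W Z) (t, x) e = 0"
proof -
  have "dir_deriv (\<lambda>y. concircular Gb y U V W Z) (t, x) e = dir_deriv (\<lambda>_. 0) (t, x) e"
    by (rule dir_deriv_cong[OF open_IS tx[OF t x]]) (use assms in auto)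
  then show ?thesis by simp
qed

text \<open>The component is \<open>A\<close> times the metric. By metric compatibility the
  derivative of the metric cancels against Christoffel terms, and only the differential of
  \<open>\<kappa>\<close> survives.\<close>

lemma cov_deriv_time:
  "cov_deriv4 Gb (concircular Gb) (t, x) (0, e) (1, 0) (0, v) (1, 0) (0, l) =
    dir_deriv (scalar_curv G) x e * G x v l / (DIM('a) * (real DIM('a) + 1))"
proof -
  have "dir_deriv (\<lambda>y. concircular Gb y (1, 0) (0, v) (1, 0) (0, l)) (t, x) (0, e) =
      dir_deriv (\<lambda>y. concircular Gb (t, y) (1, 0) (0, v) (1, 0) (0, l)) x e"
    by (rule dir_deriv_slice_snd[OF differentiable_concircular_Gb[OF t x]])
  also have "\<dots> = dir_deriv (\<lambda>y. (\<kappa> t y - p t - (q t)\<^sup>2) * F t * G y v l) x e"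
    by (rule dir_deriv_cong[OF open_S x])
      (simp add: concircular_Gb[OF t] riemann_zero G_simps wedge_def mixed_def A_def)
  also have "\<dots> = A t x * dir_deriv (\<lambda>y. G y v l) x e
      + dir_deriv (scalar_curv G) x e / (F t * (DIM('a) * (real DIM('a) + 1))) * F t * G x v l"
    unfolding A_def
    by (rule dir_deriv_eqI) (auto intro!: derivative_eq_intros has_derivative_dir_deriv
        has_derivative_kappa[OF t x] diff_G[OF x])
  finally show ?thesis
    using F_nonzero[OF t x]
    by (simp add: cov_deriv4_def christoffel_Gb[OF t x] concircular_Gb[OF t x] zeros mixed_def
        riemann_scale1[OF x] metric_compatible[OF x] wedge_def G_simps[OF x])
      (simp add: algebra_simps)
qed

lemma divergence_time:
  "divergence4 Gb (concircular Gb) (t, x) (1, 0) (0, v) (1, 0) =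
    dir_deriv (scalar_curv G) x v / (F t * (DIM('a) * (real DIM('a) + 1)))"
proof -
  have "cov_deriv4 Gb (concircular Gb) (t, x) (1, 0) (1, 0) (0, v) (1, 0) (1, 0) = 0"
    unfolding cov_deriv4_def
    by (subst dir_deriv_concircular_zero)
     (simp_all add: christoffel_Gb[OF t x] concircular_Gb riemann_zero G_simps wedge_def mixed_def x t
       christoffel_zero)
  moreover have "linear (dir_deriv (scalar_curv G) x)"
    by (rule linear_dir_deriv[OF smooth_on_differentiable[OF smooth_scalar_curv x]])
  note contract'[OF x this, of v]
  ultimately show ?thesis
    unfolding divergence4_def trace_Gb[OF t x] cov_deriv_time
    by (simp add: sum_divide_distrib[symmetric] divide_divide_eq_left mult_ac)
qed

text \<open>The hypothesis makes \<open>\<kappa>\<close> stationary in space, so the coefficient of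
  \<open>wedge\<close> contributes nothing. The time parts of the Christoffel symbols meet three
  spatial slots, where the tensor vanishes.\<close>

lemma cov_deriv_spatial:
  assumes "\<And>e. dir_deriv (scalar_curv G) x e = 0"
  shows "cov_deriv4 Gb (concircular Gb) (t, x) (0, e) (0, u) (0, v) (0, w) (0, l) =
    F t * cov_deriv4 G (riemann G) x e u v w l"
proof -
  define T where "T y u v w z = concircular Gb (t, y) (0, u) (0, v) (0, w) (0, z)" for y u v w z
  define s where "s y = ((q t)\<^sup>2 - \<kappa> t y) * (F t)\<^sup>2" for y
  have "dir_deriv (\<lambda>y. concircular Gb y (0, u) (0, v) (0, w) (0, l)) (t, x) (0, e) =
      dir_deriv (\<lambda>y. T y u v w l) x e"
    unfolding T_def by (rule dir_deriv_slice_snd[OF differentiable_concircular_Gb[OF t x]])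
  then have "cov_deriv4 Gb (concircular Gb) (t, x) (0, e) (0, u) (0, v) (0, w) (0, l) =
      cov_deriv4 G T x e u v w l"
    by (simp add: cov_deriv4_def T_def christoffel_Gb[OF t x] concircular_Gb[OF t x] mixed_def)
  moreover have s: "(s has_derivative (\<lambda>e. 0)) (at x)"
    using has_derivative_kappa[OF t x] unfolding assms s_def
    by (auto intro!: derivative_eq_intros)
  moreover have "T y u v w z = F t * riemann G y u v w z + s y * wedge y u v w z" if "y \<in> S" for y u v w z
    by (simp add: T_def s_def concircular_Gb[OF t that] mixed_def)
  ultimately show ?thesis
    using cov_deriv4_riemann_wedge[OF x, of s T "F t" e u v w l] dir_deriv_eqI[OF s]
    by (auto simp: differentiable_def)
qed

text \<open>The factor \<open>F t\<close> of the covariant derivative cancels the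
  \<open>1 / F t\<close> of the inverse metric.\<close>

lemma divergence_spatial:
  assumes "\<And>e. dir_deriv (scalar_curv G) x e = 0"
  shows "divergence4 Gb (concircular Gb) (t, x) (0, u) (0, v) (0, w) = divergence4 G (riemann G) x u v w"
proof -
  have "cov_deriv4 Gb (concircular Gb) (t, x) (1, 0) (0, u) (0, v) (0, w) (1, 0) = 0"
    unfolding cov_deriv4_def
    by (subst dir_deriv_concircular_zero)
     (simp_all add: christoffel_Gb[OF t x] concircular_Gb riemann_zero G_simps wedge_def mixed_def x t
       christoffel_zero)
  then show ?thesis
    using F_nonzero[OF t x]
    unfolding divergence4_def trace_Gb[OF t x] cov_deriv_spatial[OF assms]
    by (simp add: mult.left_commute[of _ "F t"] sum_distrib_left[symmetric])
qed

text \<open>The component is \<open>- A\<close> times the metric of \<open>M\<close>, constant in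
  time by hypothesis; the two spatial slots contribute \<open>q t\<close> once each.\<close>

lemma cov_deriv_mixed_time:
  assumes "\<And>s. s \<in> I \<Longrightarrow> A s x = A t x"
  shows "cov_deriv4 Gb (concircular Gb) (t, x) (1, 0) (1, 0) (0, v) (0, w) (1, 0) =
    2 * q t * A t x * G x v w"
proof -
  have "dir_deriv (\<lambda>y. concircular Gb y (1, 0) (0, v) (0, w) (1, 0)) (t, x) (1, 0) =
      dir_deriv (\<lambda>s. concircular Gb (s, x) (1, 0) (0, v) (0, w) (1, 0)) t 1"
    by (rule dir_deriv_slice_fst[OF differentiable_concircular_Gb[OF t x]])
  also have "\<dots> = dir_deriv (\<lambda>_. - A t x * G x v w) t 1"
    by (rule dir_deriv_cong[OF open_I t]) (simp add: concircular_Gb x zeros mixed_def assms)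
  finally show ?thesis
    by (simp add: cov_deriv4_def christoffel_Gb[OF t x] concircular_Gb[OF t x] zeros mixed_def
        G_simps[OF x] algebra_simps)
qed

text \<open>The component itself is identically zero. The connection turns the time slot into
  \<open>q t\<close> times \<open>e\<close>, which gives the curvature terms, and turns the last two
  slots into time, which gives the terms with \<open>A\<close>.\<close>

lemma cov_deriv_mixed_space:
  "cov_deriv4 Gb (concircular Gb) (t, x) (0, e) (1, 0) (0, v) (0, w) (0, l) =
    - (q t * F t * riemann G x e v w l + q t * ((q t)\<^sup>2 - \<kappa> t x) * (F t)\<^sup>2 * wedge x e v w l
      + q t * F t * A t x * (G x e w * G x v l - G x e l * G x v w))"
proof -
  have "dir_deriv (\<lambda>y. concircular Gb y (1, 0) (0, v) (0, w) (0, l)) (t, x) (0, e) = 0"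
    by (rule dir_deriv_concircular_zero)
      (simp add: concircular_Gb riemann_zero wedge_def mixed_def G_simps)
  then show ?thesis
    by (simp add: cov_deriv4_def christoffel_Gb[OF t x] concircular_Gb[OF t x] zeros mixed_def
        riemann_scale1[OF x])
      (simp add: wedge_def G_simps[OF x] algebra_simps power2_eq_square)
qed

lemma divergence_mixed:
  assumes "\<And>s. s \<in> I \<Longrightarrow> A s x = A t x"
  shows "divergence4 Gb (concircular Gb) (t, x) (1, 0) (0, v) (0, w) =
    q t * (ricci G x v w - ((real DIM('a) - 1) * p t * F t + 2 * A t x) * G x v w)"
proof -
  have wedge_antisym: "wedge x u v w z = - wedge x v u w z" for u v w z
    by (simp add: wedge_def)
  \<comment> \<open>Antisymmetry moves the contracted index from the first slot to the second, where
    \<open>ricci\<close> contracts.\<close>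
  have "h x i j * cov_deriv4 Gb (concircular Gb) (t, x) (0, i) (1, 0) (0, v) (0, w) (0, j) =
      q t * F t * (h x i j * riemann G x v i w j)
      + q t * ((q t)\<^sup>2 - \<kappa> t x) * (F t)\<^sup>2 * (h x i j * wedge x v i w j)
      - q t * F t * A t x * (h x i j * (G x w i * G x v j))
      + q t * F t * A t x * G x v w * (h x i j * G x i j)" for i j
    unfolding cov_deriv_mixed_space
    by (simp add: riemann_antisym[OF x, of i v] wedge_antisym[of i v] sym_G[OF x, of i w] algebra_simps)
  then have space: "(\<Sum>i\<in>Basis. \<Sum>j\<in>Basis.
        h x i j * cov_deriv4 Gb (concircular Gb) (t, x) (0, i) (1, 0) (0, v) (0, w) (0, j)) =
      q t * F t * ricci G x v w
      + q t * ((q t)\<^sup>2 - \<kappa> t x) * (F t)\<^sup>2 * ((real DIM('a) - 1) * G x v w)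
      - q t * F t * A t x * G x v w
      + q t * F t * A t x * G x v w * real DIM('a)"
    by (simp only: sum.distrib sum_subtractf sum_distrib_left[symmetric] ricci_def
        trace_wedge[OF x] contract[OF x linear_G(1)[OF x]] contract_G[OF x])
  have time: "cov_deriv4 Gb (concircular Gb) (t, x) (1, 0) (1, 0) (0, v) (0, w) (1, 0) =
      2 * q t * A t x * G x v w"
    by (rule cov_deriv_mixed_time) (rule assms)
  \<comment> \<open>By definition of \<open>A\<close>,
    \<open>((q t)\<^sup>2 - \<kappa> t x) * F t + A t x = - p t * F t\<close>; this removes
    \<open>\<kappa>\<close> from the coefficient \<open>n - 1\<close>.\<close>
  show ?thesis
    using F_nonzero[OF t x]
    unfolding divergence4_def trace_Gb[OF t x] space time
    by (simp add: A_def field_simps power2_eq_square)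
qed

end

text \<open>With stationary scalar curvature the two tensors differ by a multiple of
  \<open>wedge\<close> whose coefficient has zero differential.\<close>

lemma divergence_concircular:
  assumes x: "x \<in> S" and "\<And>e. dir_deriv (scalar_curv G) x e = 0"
  shows "divergence4 G (concircular G) x u v w = divergence4 G (riemann G) x u v w"
proof -
  define s where "s y = - scalar_curv G y / (DIM('a) * (real DIM('a) - 1))" for y
  have s: "(s has_derivative (\<lambda>e. 0)) (at x)"
    using has_derivative_dir_deriv[OF smooth_on_differentiable[OF smooth_scalar_curv x]] assms(2)
    unfolding s_def divide_inverse by (auto intro!: derivative_eq_intros)
  have "concircular G y u v w z = 1 * riemann G y u v w z + s y * wedge y u v w z" for y u v w z
    by (simp add: concircular_def wedge_def s_def)
  moreover have "s differentiable at x"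
    using s unfolding differentiable_def by blast
  ultimately show ?thesis
    using cov_deriv4_riemann_wedge[OF x, of s "concircular G" 1]
    by (simp add: divergence4_def dir_deriv_eqI[OF s])
qed

section \<open>Consequences in one chart of \<open>M\<close>\<close>

context
  assumes I_nonempty: "I \<noteq> {}"
    and divergence_free: "\<And>t x u v w. t \<in> I \<Longrightarrow> x \<in> S \<Longrightarrow> divergence4 Gb (concircular Gb) (t, x) u v w = 0"
begin

lemma scalar_curv_stationary:
  assumes x: "x \<in> S"
  shows "dir_deriv (scalar_curv G) x e = 0"
proof -
  obtain t where t: "t \<in> I" using I_nonempty by blast
  have "real DIM('a) * (real DIM('a) + 1) > 0" by (intro mult_pos_pos add_pos_pos) simp_all
  then show ?thesis
    using divergence_time[OF t x, of e] divergence_free[OF t x] F_pos[OF t] by simp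
qed

lemma base_divergence_free:
  assumes x: "x \<in> S"
  shows "divergence4 G (concircular G) x u v w = 0"
proof -
  obtain t where t: "t \<in> I" using I_nonempty by blast
  show ?thesis
    using divergence_concircular[OF x scalar_curv_stationary[OF x]]
      divergence_spatial[OF t x scalar_curv_stationary[OF x]] divergence_free[OF t x] by simp
qed

text \<open>
  The hypotheses on \<open>p\<close>, \<open>q\<close> and \<open>F\<close> say \<open>f'' = 0\<close> and \<open>f'\<^sup>2 = a\<^sup>2\<close>. The trace of the
  resulting equation determines the scalar curvature, so that the Einstein constant is the same
  on all components of the manifold.
\<close>

lemma base_einstein:
  assumes x: "x \<in> S" and dim: "DIM('a) \<ge> 2" and "a \<noteq> 0"
    and p: "\<And>t. t \<in> I \<Longrightarrow> p t + (q t)\<^sup>2 = 0" and q: "\<And>t. t \<in> I \<Longrightarrow> (q t)\<^sup>2 * F t = a\<^sup>2"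
  shows "ricci G x u v = - (real DIM('a) - 1) * a\<^sup>2 * G x u v"
proof -
  obtain t where t: "t \<in> I" using I_nonempty by blast
  define n where "n = real DIM('a)"
  \<comment> \<open>The common value of \<open>A\<close> at all times, obtained from
    \<open>kappa_eq\<close> by inserting \<open>p + q\<^sup>2 = 0\<close> and
    \<open>q\<^sup>2 * F = a\<^sup>2\<close>. Its independence of time is the hypothesis of
    \<open>divergence_mixed\<close>.\<close>
  define B where "B = (scalar_curv G x + n * (n - 1) * a\<^sup>2) / (n * (n + 1))"
  have n: "n \<ge> 2" using dim by (simp add: n_def)
  have A: "A s x = B" if s: "s \<in> I" for s
  proof -
    have "p s = - (q s)\<^sup>2" using p[OF s] by simp
    then have "A s x = \<kappa> s x * F s" by (simp add: A_def)
    also have "\<dots> = scalar_curv G x / (n * (n + 1)) + (n - 1) * ((q s)\<^sup>2 * F s) / (n + 1)"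
      using F_nonzero[OF s x] by (simp add: kappa_eq[OF s x] p[OF s] n_def distrib_right)
    also have "\<dots> = B"
      using n unfolding q[OF s] B_def by (simp add: add_divide_distrib)
    finally show ?thesis .
  qed
  have pF: "p t * F t = - a\<^sup>2"
  proof -
    have "p t = - (q t)\<^sup>2" using p[OF t] by simp
    then show ?thesis using q[OF t] by simp
  qed
  \<comment> \<open>Here \<open>a \<noteq> 0\<close> enters: the component carries the factor
    \<open>q t\<close>, which has to be cancelled.\<close>
  have "q t \<noteq> 0" using q[OF t] \<open>a \<noteq> 0\<close> by auto
  then have ric: "ricci G x u v = (2 * B - (n - 1) * a\<^sup>2) * G x u v" for u v
    using divergence_mixed[OF t x, of u v] divergence_free[OF t x] A t pF
    by (simp add: n_def mult.assoc)
  have "h x i j * ricci G x i j = (2 * B - (n - 1) * a\<^sup>2) * (h x i j * G x i j)" for i j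
    by (simp add: ric)
  then have "scalar_curv G x = (2 * B - (n - 1) * a\<^sup>2) * n"
    unfolding scalar_curv_def by (simp only: sum_distrib_left[symmetric] contract_G[OF x] n_def)
  moreover have "scalar_curv G x = n * (n + 1) * B - n * (n - 1) * a\<^sup>2"
    using n by (simp add: B_def)
  \<comment> \<open>The trace of the equation and the definition of \<open>B\<close> both express
    the scalar curvature through \<open>B\<close>; comparing them forces
    \<open>B = 0\<close>.\<close>
  ultimately have "n * (n - 1) * B = 0" by (simp add: algebra_simps)
  then have "B = 0" using n by simp
  then show ?thesis using ric by (simp add: n_def algebra_simps)
qed

end

end

section \<open>Passage from charts to the manifold\<close>

lemma chart_metric_of_manifold:
  assumes "pseudo_riemannian_manifold M" "i \<in> charts M"
  shows "chart_metric (img M i) (met M i)"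
proof
  have "smooth_manifold M" using assms(1) by (simp add: pseudo_riemannian_manifold_def)
  then show "open (img M i)" using assms(2) by (simp add: smooth_manifold_def)
qed (use assms in \<open>auto simp: pseudo_riemannian_manifold_def\<close>)

lemma smooth_on_real_derivative:
  fixes f :: "real \<Rightarrow> real"
  assumes "smooth_on f I" "t \<in> I"
  shows "(f has_real_derivative dir_deriv f t 1) (at t)"
proof -
  have f: "(f has_derivative dir_deriv f t) (at t)"
    by (rule has_derivative_dir_deriv[OF smooth_on_differentiable[OF assms]])
  then have "dir_deriv f t v = dir_deriv f t 1 * v" for v
    using linear_scale[OF has_derivative_linear[OF f], of v 1] by simp
  with f show ?thesis
    unfolding has_field_derivative_def by (metis ext)
qed

text \<open>The logarithmic derivative \<open>q = f' / f\<close> satisfies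
  \<open>(f\<^sup>2)' = 2 * q * f\<^sup>2\<close>, and the quotient rule gives
  \<open>p\<close>.\<close>

lemma warped_of_warping_function:
  fixes f :: "real \<Rightarrow> real"
  defines "f' \<equiv> \<lambda>t. dir_deriv f t 1"
  defines "f'' \<equiv> \<lambda>t. dir_deriv f' t 1"
  assumes "chart_metric S G" "open I" "smooth_on f I" and pos: "\<And>t. t \<in> I \<Longrightarrow> f t > 0"
  shows "warped S G I (\<lambda>t. (f t)\<^sup>2) (\<lambda>t. f' t / f t) (\<lambda>t. f'' t / f t - (f' t / f t)\<^sup>2)"
proof -
  interpret chart_metric S G by fact
  have smooth: "smooth_on f' I" "smooth_on f'' I"
    unfolding f''_def f'_def by (intro smooth_on_dir_deriv assms)+
  have d: "(f has_real_derivative f' t) (at t)" "(f' has_real_derivative f'' t) (at t)" if "t \<in> I" for t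
    unfolding f''_def using smooth_on_real_derivative[OF _ that] assms(5) smooth(1)
    by (auto simp: f'_def)
  show ?thesis
  proof
    fix t assume t: "t \<in> I"
    note f = pos[OF t]
    show "((\<lambda>t. (f t)\<^sup>2) has_real_derivative 2 * (f' t / f t) * (f t)\<^sup>2) (at t)"
      by (rule derivative_eq_intros d t | use f in \<open>simp add: power2_eq_square\<close>)+
    show "((\<lambda>t. f' t / f t) has_real_derivative f'' t / f t - (f' t / f t)\<^sup>2) (at t)"
      by (rule derivative_eq_intros d t | use f in \<open>simp add: power2_eq_square field_simps\<close>)+
    show "(\<lambda>t. f'' t / f t - (f' t / f t)\<^sup>2) differentiable at t"
      using f by (intro differentiable_diff differentiable_divide differentiable_power
          smooth_on_differentiable[OF smooth(1) t] smooth_on_differentiable[OF smooth(2) t]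
          smooth_on_differentiable[OF assms(5) t]) auto
  qed (use assms(4) pos in \<open>auto simp: less_imp_neq[THEN not_sym]\<close>)
qed

lemma img_grw: "img (grw I f M) i = I \<times> img M i"
  unfolding img_def grw_def by (force simp: image_iff)

theorem corollary3:
  fixes M :: "('i, 'p, 'a::euclidean_space) mfd"
    and I :: "real set"
    and f :: "real \<Rightarrow> real"
  assumes "pseudo_riemannian_manifold M"
    and "DIM('a) \<ge> 3"
    and "open I" and "is_interval I" and "I \<noteq> {}"
    and "smooth_on f I" and "\<And>t. t \<in> I \<Longrightarrow> f t > 0"
    and "concircular_divergence_free (grw I f M)"
  shows "concircular_divergence_free M \<and>
    (\<forall>a b. a \<noteq> 0 \<longrightarrow> (\<forall>t\<in>I. f t = a * t + b) \<longrightarrow> einstein M)"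
proof -
  define f' where "f' t = dir_deriv f t 1" for t
  define f'' where "f'' t = dir_deriv f' t 1" for t
  have warped: "warped (img M i) (met M i) I (\<lambda>t. (f t)\<^sup>2) (\<lambda>t. f' t / f t)
      (\<lambda>t. f'' t / f t - (f' t / f t)\<^sup>2)" if "i \<in> charts M" for i
    unfolding f''_def f'_def
    by (intro warped_of_warping_function chart_metric_of_manifold assms that)
  have Gb: "met (grw I f M) i = warped.Gb (met M i) (\<lambda>t. (f t)\<^sup>2)" if "i \<in> charts M" for i
    unfolding warped.Gb_def[OF warped[OF that]] by (simp add: grw_def)
  have div: "divergence4 (warped.Gb (met M i) (\<lambda>t. (f t)\<^sup>2))
      (concircular (warped.Gb (met M i) (\<lambda>t. (f t)\<^sup>2))) (t, x) u v w = 0"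
    if "i \<in> charts M" "t \<in> I" "x \<in> img M i" for i t x u v w
  proof -
    have "i \<in> charts (grw I f M)" "(t, x) \<in> img (grw I f M) i"
      using that by (simp add: grw_def, simp add: img_grw)
    then show ?thesis
      using assms(8) Gb[OF that(1)] unfolding concircular_divergence_free_def by metis
  qed
  have "concircular_divergence_free M"
    unfolding concircular_divergence_free_def
    using warped.base_divergence_free[OF warped assms(5) div] by blast
  moreover have "einstein M" if "a \<noteq> 0" and f: "\<forall>t\<in>I. f t = a * t + b" for a b
  proof -
    have f': "f' t = a" if "t \<in> I" for t
    proof -
      have "f' t = dir_deriv (\<lambda>t. a * t + b) t 1"
        unfolding f'_def by (rule dir_deriv_cong[OF assms(3) that]) (use f in auto)
      also have "\<dots> = a * 1"
        by (rule dir_deriv_eqI) (auto intro!: derivative_eq_intros)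
      finally show ?thesis by simp
    qed
    have f'': "f'' t = 0" if "t \<in> I" for t
      unfolding f''_def using dir_deriv_cong[OF assms(3) that f'] by simp
    \<comment> \<open>The constant is explicit and the same in every chart, as
      \<open>einstein\<close> demands.\<close>
    have "ricci (met M i) x u v = - (real DIM('a) - 1) * a\<^sup>2 * met M i x u v"
      if "i \<in> charts M" "x \<in> img M i" for i x u v
    proof (rule warped.base_einstein[OF warped[OF that(1)] assms(5) div[OF that(1)] that(2) _ \<open>a \<noteq> 0\<close>])
      fix t assume t: "t \<in> I"
      show "f'' t / f t - (f' t / f t)\<^sup>2 + (f' t / f t)\<^sup>2 = 0"
        using f'' t by simp
      show "(f' t / f t)\<^sup>2 * (f t)\<^sup>2 = a\<^sup>2"
        using f'[OF t] assms(7)[OF t] by (simp add: power_divide)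
    qed (use assms(2) in auto)
    then show ?thesis unfolding einstein_def by blast
  qed
  ultimately show ?thesis by blast
qed

end
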